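(* For every positive integer $n$, the order $|\widehat{A_n}|$ of the group of semicharacters of the alternating group $A_n$ is divisible by $|A_n|$.
   Context: A semicharacter of a finite group $G$ is a function $f:G\to\mathbb{C}^{*}$ satisfying $f(ab)=f(a)f(b)$ for all pairs of commuting elements $a,b\in G$. The set $\widehat{G}$ of all semicharacters of $G$ is an abelian group under pointwise multiplication (it is finite whenever $G$ is finite). *)

theory Defs
  imports Complex_Main "HOL-Algebra.Multiplicative_Group" "HOL-Algebra.Sym_Groups"
begin

definition semichars :: "('a, 'b) monoid_scheme \<Rightarrow> ('a \<Rightarrow> complex) set" where
  "semichars G = {f \<in> carrier G \<rightarrow>\<^sub>E (UNIV - {0}).
     \<forall>a\<in>carrier G. \<forall>b\<in>carrier G. a \<otimes>\<^bsub>G\<^esub> b = b \<otimes>\<^bsub>G\<^esub> a \<longrightarrow> f (a \<otimes>\<^bsub>G\<^esub> b) = f a * f b}"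

text \<open>
  Semicharacters are taken to be extensional (\<open>undefined\<close> outside the carrier), so that each function
  on the carrier is represented exactly once and the order of the group below is the number of
  semicharacters.
\<close>
definition semichar_group :: "('a, 'b) monoid_scheme \<Rightarrow> ('a \<Rightarrow> complex) monoid" where
  "semichar_group G = \<lparr> carrier = semichars G,
     monoid.mult = (\<lambda>f g. \<lambda>x\<in>carrier G. f x * g x),
     one = (\<lambda>x\<in>carrier G. 1) \<rparr>"

lemma comm_group_semichar_group:
  assumes "group G"
  shows "comm_group (semichar_group G)"
proof -
  interpret G: group G by fact
  show ?thesis
  proof (rule comm_groupI)
    fix f g assume "f \<in> carrier (semichar_group G)" "g \<in> carrier (semichar_group G)"
    then show "f \<otimes>\<^bsub>semichar_group G\<^esub> g \<in> carrier (semichar_group G)"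
      by (auto simp: semichar_group_def semichars_def)
  next
    show "\<one>\<^bsub>semichar_group G\<^esub> \<in> carrier (semichar_group G)"
      by (auto simp: semichar_group_def semichars_def)
  next
    fix f g h
    show "f \<otimes>\<^bsub>semichar_group G\<^esub> g \<otimes>\<^bsub>semichar_group G\<^esub> h
        = f \<otimes>\<^bsub>semichar_group G\<^esub> (g \<otimes>\<^bsub>semichar_group G\<^esub> h)"
      by (auto simp: semichar_group_def fun_eq_iff)
  next
    fix f g
    show "f \<otimes>\<^bsub>semichar_group G\<^esub> g = g \<otimes>\<^bsub>semichar_group G\<^esub> f"
      by (auto simp: semichar_group_def fun_eq_iff)
  next
    fix f assume "f \<in> carrier (semichar_group G)"
    then have "f \<in> extensional (carrier G)"
      by (auto simp: semichar_group_def semichars_def PiE_iff)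
    then show "\<one>\<^bsub>semichar_group G\<^esub> \<otimes>\<^bsub>semichar_group G\<^esub> f = f"
      by (auto simp: semichar_group_def fun_eq_iff extensional_def)
  next
    fix f assume "f \<in> carrier (semichar_group G)"
    then have f: "f \<in> semichars G"
      by (simp add: semichar_group_def)
    let ?g = "\<lambda>x\<in>carrier G. inverse (f x)"
    have nz: "f x \<noteq> 0" if "x \<in> carrier G" for x
      using f that by (auto simp: semichars_def)
    have "?g \<in> semichars G"
      using f nz by (auto simp: semichars_def)
    moreover have "(\<lambda>x\<in>carrier G. ?g x * f x) = (\<lambda>x\<in>carrier G. 1)"
      by (rule restrict_ext) (simp add: nz)
    ultimately show "\<exists>g\<in>carrier (semichar_group G).
        g \<otimes>\<^bsub>semichar_group G\<^esub> f = \<one>\<^bsub>semichar_group G\<^esub>"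
      unfolding semichar_group_def by (intro bexI[of _ ?g]) (simp_all only: monoid.simps partial_object.simps)
  qed
qed

text \<open>
  \<^const>\<open>order\<close> is \<open>0\<close> on infinite carriers, which would make divisibility statements about it
  vacuous; the following excludes this for finite groups.
\<close>
lemma finite_semichar_group:
  assumes "group G" "finite (carrier G)"
  shows "finite (carrier (semichar_group G))"
proof -
  interpret G: group G by fact
  have pos: "order G > 0"
    using assms(2) G.order_gt_0_iff_finite by blast
  have "f x ^ order G = 1" if f: "f \<in> semichars G" and x: "x \<in> carrier G" for f x
  proof -
    have mul: "f (a \<otimes>\<^bsub>G\<^esub> b) = f a * f b"
      if "a \<in> carrier G" "b \<in> carrier G" "a \<otimes>\<^bsub>G\<^esub> b = b \<otimes>\<^bsub>G\<^esub> a" for a b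
      using f that by (auto simp: semichars_def)
    have "f \<one>\<^bsub>G\<^esub> \<noteq> 0"
      using f by (auto simp: semichars_def)
    moreover have "f \<one>\<^bsub>G\<^esub> = f \<one>\<^bsub>G\<^esub> * f \<one>\<^bsub>G\<^esub>"
      using mul[of "\<one>\<^bsub>G\<^esub>" "\<one>\<^bsub>G\<^esub>"] by simp
    ultimately have one: "f \<one>\<^bsub>G\<^esub> = 1"
      by simp
    have "f (x [^]\<^bsub>G\<^esub> k) = f x ^ k" for k :: nat
    proof (induction k)
      case 0
      then show ?case using one by simp
    next
      case (Suc k)
      have "x [^]\<^bsub>G\<^esub> k \<otimes>\<^bsub>G\<^esub> x = x \<otimes>\<^bsub>G\<^esub> x [^]\<^bsub>G\<^esub> k"
        using G.nat_pow_Suc2[OF x, of k] by simp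
      then show ?case using Suc mul[of "x [^]\<^bsub>G\<^esub> k" x] x by simp
    qed
    from this[of "order G"] show ?thesis
      using one G.pow_order_eq_1[OF x] by simp
  qed
  then have roots: "f x \<in> {z. z ^ order G = 1}" if "f \<in> semichars G" "x \<in> carrier G" for f x
    using that by simp
  have "semichars G \<subseteq> carrier G \<rightarrow>\<^sub>E {z. z ^ order G = 1}"
  proof (intro subsetI PiE_I)
    fix f x assume "f \<in> semichars G" "x \<notin> carrier G"
    then show "f x = undefined"
      unfolding semichars_def by (blast intro: PiE_arb)
  qed (rule roots)
  moreover have "finite (carrier G \<rightarrow>\<^sub>E {z :: complex. z ^ order G = 1})"
    using assms(2) pos by (intro finite_PiE finite_roots_unity) auto
  ultimately show ?thesis
    by (simp add: semichar_group_def finite_subset)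
qed

end

theory Submission
  imports Defs "HOL-Number_Theory.Cong"
begin

text \<open>
  It suffices to find, for every prime \<open>p\<close>, a subgroup of exponent \<open>p\<close> and order at least the
  \<open>p\<close>-part of \<open>n!/2\<close>. A function on the \<open>p\<close>-elements that is multiplicative on commuting pairs extends
  to a semicharacter. Let \<open>C\<close> be generated by a cycle of length \<open>q = p\<^sup>k\<close>, with \<open>q\<close> maximal (for \<open>p = 2\<close>:
  maximal with \<open>q + 2 \<le> n\<close>). A \<open>p\<close>-element acting on the support of the cycle as a generator of \<open>C\<close>
  (and, for \<open>p = 2\<close>, having no other cycle of length \<open>q\<close>) commutes only with \<open>p\<close>-elements acting there through \<open>C\<close>, so a character of order \<open>p\<close> of \<open>C\<close> yields a
  semicharacter. Among its conjugates, \<open>n - 2\<close> are independent, and the exponent of \<open>p\<close> in \<open>n!/2\<close>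
  is at most \<open>n - 2\<close>. For \<open>p = 2\<close> and \<open>n = 4, 5\<close> the Klein four-group replaces \<open>C\<close>.
\<close>

section \<open>Independent families of semicharacters\<close>

text \<open>Were two powers equal, the difference \<open>d\<close> of the exponents would satisfy
  \<open>z ^ d = 1\<close> with \<open>0 < d < p\<close>; as \<open>d\<close> is invertible modulo
  \<open>p\<close>, raising to its inverse would give \<open>z = 1\<close>.\<close>

lemma root_of_unity_power_inj:
  fixes z :: complex
  assumes "prime p" "z ^ p = 1" "z \<noteq> 1" "z ^ a = z ^ b" "a < p" "b < p"
  shows "a = b"
proof (rule ccontr)
  have *: False if ab: "a < b" "b < p" "z ^ a = z ^ b" for a b
  proof -
    have "z \<noteq> 0"
      using assms(2) prime_gt_0_nat[OF assms(1)] by (auto simp: power_0_left split: if_splits)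
    have "z ^ b = z ^ a * z ^ (b - a)"
      using ab(1) by (simp flip: power_add)
    then have d: "z ^ (b - a) = 1"
      using ab(3) \<open>z \<noteq> 0\<close> by simp
    have "\<not> p dvd b - a"
      using ab by (auto dest: dvd_imp_le)
    then have "coprime (b - a) p"
      using \<open>prime p\<close> by (simp add: coprime_commute prime_imp_coprime)
    then obtain u where u: "[(b - a) * u = 1] (mod p)"
      using cong_solve_coprime_nat by auto
    have "z ^ ((b - a) * u) = z"
    proof -
      have "z ^ ((b - a) * u) = z ^ (((b - a) * u) mod p)"
        using assms(2) by (metis mod_mult_div_eq power_add power_mult power_one mult.right_neutral)
      also have "((b - a) * u) mod p = 1"
        using u prime_gt_1_nat[OF \<open>prime p\<close>] by (simp add: cong_def)
      finally show ?thesis by simp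
    qed
    then show False
      using d \<open>z \<noteq> 1\<close> by (simp add: power_mult)
  qed
  assume "a \<noteq> b"
  then show False
    using *[of a b] *[of b a] assms by (metis linorder_neqE_nat)
qed

lemma semichars_mult:
  "f \<in> semichars G \<Longrightarrow> a \<in> carrier G \<Longrightarrow> b \<in> carrier G \<Longrightarrow> a \<otimes>\<^bsub>G\<^esub> b = b \<otimes>\<^bsub>G\<^esub> a \<Longrightarrow>
    f (a \<otimes>\<^bsub>G\<^esub> b) = f a * f b"
  by (simp add: semichars_def)

lemma semichars_nonzero: "f \<in> semichars G \<Longrightarrow> a \<in> carrier G \<Longrightarrow> f a \<noteq> 0"
  by (auto simp: semichars_def)

text \<open>The products of the \<open>F i\<close> with exponents below \<open>p\<close> form a
  subgroup, to which Lagrange applies. Evaluation at \<open>x j\<close> kills every factor except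
  the \<open>j\<close>-th and so recovers the exponent \<open>e j\<close>; hence different exponent
  vectors give different products.\<close>

lemma prime_power_dvd_order_semichar_group:
  assumes "group G" "finite (carrier G)" and p: "prime p" and I: "finite I"
    and F: "\<And>i. i \<in> I \<Longrightarrow> F i \<in> semichars G"
    and pow: "\<And>i s. i \<in> I \<Longrightarrow> s \<in> carrier G \<Longrightarrow> F i s ^ p = 1"
    and x: "\<And>i. i \<in> I \<Longrightarrow> x i \<in> carrier G"
    and diag: "\<And>i. i \<in> I \<Longrightarrow> F i (x i) \<noteq> 1"
    and off_diag: "\<And>i j. i \<in> I \<Longrightarrow> j \<in> I \<Longrightarrow> i \<noteq> j \<Longrightarrow> F i (x j) = 1"
  shows "p ^ card I dvd order (semichar_group G)"
proof -
  interpret G: group G by fact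
  interpret H: comm_group "semichar_group G"
    using assms(1) by (rule comm_group_semichar_group)
  \<comment> \<open>Exponent vectors are arbitrary here and are reduced modulo \<open>p\<close> only
    in \<open>restr\<close>, so that multiplication is plain addition of exponents.\<close>
  define \<Phi> where "\<Phi> e = (\<lambda>s\<in>carrier G. \<Prod>i\<in>I. F i s ^ e i)" for e :: "'c \<Rightarrow> nat"
  define E where "E = (I \<rightarrow>\<^sub>E {..<p})"
  have p0: "p > 0"
    using p by (rule prime_gt_0_nat)
  have carr: "\<Phi> e \<in> carrier (semichar_group G)" for e
  proof -
    have "\<Phi> e \<in> carrier G \<rightarrow>\<^sub>E UNIV - {0}"
      using I semichars_nonzero[OF F] by (auto simp: \<Phi>_def)
    moreover have "\<Phi> e (a \<otimes>\<^bsub>G\<^esub> b) = \<Phi> e a * \<Phi> e b"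
      if "a \<in> carrier G" "b \<in> carrier G" "a \<otimes>\<^bsub>G\<^esub> b = b \<otimes>\<^bsub>G\<^esub> a" for a b
      using that semichars_mult[OF F that]
      by (auto simp: \<Phi>_def power_mult_distrib simp flip: prod.distrib intro!: prod.cong)
    ultimately show ?thesis
      by (simp add: semichar_group_def semichars_def)
  qed
  have red: "F i s ^ (k mod p) = F i s ^ k" if "i \<in> I" "s \<in> carrier G" for i s k
    using pow[OF that] by (metis mod_mult_div_eq power_add power_mult power_one mult.right_neutral)
  have restr: "\<exists>e'\<in>E. \<Phi> e' = \<Phi> e" for e
  proof (rule bexI[of _ "\<lambda>i\<in>I. e i mod p"])
    show "\<Phi> (\<lambda>i\<in>I. e i mod p) = \<Phi> e"
      unfolding \<Phi>_def by (rule restrict_ext, rule prod.cong) (simp_all add: red)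
    show "(\<lambda>i\<in>I. e i mod p) \<in> E"
      using p0 by (auto simp: E_def)
  qed
  have mult: "\<Phi> e \<otimes>\<^bsub>semichar_group G\<^esub> \<Phi> e' = \<Phi> (\<lambda>i. e i + e' i)" for e e'
    by (auto simp: \<Phi>_def semichar_group_def fun_eq_iff power_add prod.distrib)
  \<comment> \<open>Writing the identity with all exponents equal to \<open>p\<close> lets
    \<open>p - e i\<close> serve as the exponent of the inverse within the naturals.\<close>
  have one: "\<one>\<^bsub>semichar_group G\<^esub> = \<Phi> (\<lambda>i. p)"
    using pow by (auto simp: \<Phi>_def semichar_group_def fun_eq_iff)
  have inv: "inv\<^bsub>semichar_group G\<^esub> \<Phi> e = \<Phi> (\<lambda>i. p - e i)" if "e \<in> E" for e
  proof (rule H.inv_equality)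
    have "\<Phi> (\<lambda>i. p - e i + e i) = \<Phi> (\<lambda>i. p)"
      unfolding \<Phi>_def
    proof (rule restrict_ext, rule prod.cong)
      fix i s assume "i \<in> I"
      then have "e i < p" using that by (auto simp: E_def)
      then show "F i s ^ (p - e i + e i) = F i s ^ p" by simp
    qed simp
    then show "\<Phi> (\<lambda>i. p - e i) \<otimes>\<^bsub>semichar_group G\<^esub> \<Phi> e = \<one>\<^bsub>semichar_group G\<^esub>"
      unfolding mult one .
  qed (rule carr)+
  have "subgroup (\<Phi> ` E) (semichar_group G)"
  proof (rule H.subgroupI)
    show "\<Phi> ` E \<subseteq> carrier (semichar_group G)"
      using carr by blast
    show "\<Phi> ` E \<noteq> {}"
      using restr by blast
    show "inv\<^bsub>semichar_group G\<^esub> a \<in> \<Phi> ` E" if "a \<in> \<Phi> ` E" for a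
      using that inv restr by (metis (no_types, lifting) image_iff)
    show "a \<otimes>\<^bsub>semichar_group G\<^esub> b \<in> \<Phi> ` E" if "a \<in> \<Phi> ` E" "b \<in> \<Phi> ` E" for a b
      using that mult restr by (metis (no_types, lifting) image_iff)
  qed
  then have "card (\<Phi> ` E) dvd order (semichar_group G)"
    using H.lagrange by (metis dvd_triv_right)
  moreover have "inj_on \<Phi> E"
  proof (rule inj_onI)
    fix e e' assume e: "e \<in> E" "e' \<in> E" and eq: "\<Phi> e = \<Phi> e'"
    have val: "\<Phi> u (x j) = F j (x j) ^ u j" if "j \<in> I" for u j
    proof -
      have "\<Phi> u (x j) = (\<Prod>i\<in>I. if i = j then F j (x j) ^ u j else 1)"
        using x[OF that] that off_diag by (auto simp: \<Phi>_def intro!: prod.cong)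
      then show ?thesis
        using I that by simp
    qed
    show "e = e'"
    proof (rule PiE_ext)
      show "e \<in> I \<rightarrow>\<^sub>E {..<p}" "e' \<in> I \<rightarrow>\<^sub>E {..<p}"
        using e by (simp_all add: E_def)
      fix j assume j: "j \<in> I"
      have "e j < p" "e' j < p"
        using e j by (auto simp: E_def)
      then show "e j = e' j"
        using root_of_unity_power_inj[OF p pow[OF j x[OF j]] diag[OF j]] val[OF j] eq by metis
    qed
  qed
  then have "card (\<Phi> ` E) = p ^ card I"
    using I by (simp add: card_image E_def card_PiE)
  ultimately show ?thesis
    by simp
qed

section \<open>Semicharacters and elements of prime power order\<close>

definition p_elements :: "('a, 'b) monoid_scheme \<Rightarrow> nat \<Rightarrow> 'a set" where
  "p_elements G p = {x \<in> carrier G. \<exists>k. x [^]\<^bsub>G\<^esub> (p ^ k :: nat) = \<one>\<^bsub>G\<^esub>}"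

context group
begin

lemma commuting_nat_pow:
  assumes "x \<in> carrier G" "y \<in> carrier G" "x \<otimes> y = y \<otimes> x"
  shows "x [^] (i :: nat) \<otimes> y [^] (j :: nat) = y [^] j \<otimes> x [^] i"
proof -
  have *: "a [^] i \<otimes> b = b \<otimes> a [^] i"
    if "a \<in> carrier G" "b \<in> carrier G" "a \<otimes> b = b \<otimes> a" for a b and i :: nat
    using that by (induction i) (simp_all add: m_assoc, metis m_assoc nat_pow_closed)
  show ?thesis
    using *[of x "y [^] j" i] *[of y x j] assms by simp
qed

lemma p_elements_mult:
  assumes "x \<in> p_elements G p" "y \<in> p_elements G p" "x \<otimes> y = y \<otimes> x"
  shows "x \<otimes> y \<in> p_elements G p"
proof -
  obtain k l where kl: "x [^] (p ^ k :: nat) = \<one>" "y [^] (p ^ l :: nat) = \<one>"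
    and c: "x \<in> carrier G" "y \<in> carrier G"
    using assms unfolding p_elements_def by blast
  have "x [^] (p ^ (k + l) :: nat) = \<one>"
    using kl(1) c by (metis nat_pow_pow nat_pow_one power_add)
  moreover have "y [^] (p ^ (k + l) :: nat) = \<one>"
    using kl(2) c by (metis mult.commute nat_pow_pow nat_pow_one power_add)
  ultimately have "(x \<otimes> y) [^] (p ^ (k + l) :: nat) = \<one>"
    using c assms(3) by (simp add: pow_mult_distrib)
  then show ?thesis
    using c by (auto simp: p_elements_def)
qed

text \<open>The extension is \<open>s \<mapsto> F (s\<^sup>M)\<close>, where \<open>M\<close> is divisible by the part of \<open>order G\<close>
  prime to \<open>p\<close> and congruent to \<open>1\<close> modulo the \<open>p\<close>-part.\<close>
lemma semichar_extension:
  fixes F :: "'a \<Rightarrow> complex"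
  assumes fin: "finite (carrier G)" and p: "prime p"
    and mult: "\<And>x y. x \<in> p_elements G p \<Longrightarrow> y \<in> p_elements G p \<Longrightarrow> x \<otimes> y = y \<otimes> x \<Longrightarrow>
      F (x \<otimes> y) = F x * F y"
    and nz: "\<And>x. x \<in> p_elements G p \<Longrightarrow> F x \<noteq> 0"
  shows "\<exists>f\<in>semichars G. (\<forall>x\<in>p_elements G p. f x = F x) \<and> f ` carrier G \<subseteq> F ` p_elements G p"
proof -
  have N: "order G \<noteq> 0"
    using fin by (simp add: order_gt_0_iff_finite[symmetric])
  have "\<not> is_unit p"
    using p by auto
  then obtain m where m: "order G = p ^ multiplicity p (order G) * m" "\<not> p dvd m"
    using multiplicity_decompose'[OF N] by blast
  define a where "a = multiplicity p (order G)"
  have "coprime m (p ^ a)"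
    using m(2) p by (metis coprime_commute coprime_power_right_iff prime_imp_coprime)
  then obtain u where u: "[m * u = 1] (mod p ^ a)"
    using cong_solve_coprime_nat[of m "p ^ a"] by (metis One_nat_def)
  define M where "M = m * u"
  have Mp: "s [^] M \<in> p_elements G p" if "s \<in> carrier G" for s
  proof -
    have "(s [^] M) [^] (p ^ a) = (s [^] order G) [^] u"
      using that unfolding M_def a_def nat_pow_pow[OF that] by (subst (2) m(1)) (simp add: mult_ac)
    then show ?thesis
      using that pow_order_eq_1[OF that] by (auto simp: p_elements_def)
  qed
  have id: "x [^] M = x" if x_P: "x \<in> p_elements G p" for x
  proof -
    obtain k where x: "x \<in> carrier G" and k: "x [^] (p ^ k :: nat) = \<one>"
      using x_P unfolding p_elements_def by blast
    \<comment> \<open>The order of \<open>x\<close> is a power of \<open>p\<close> and divides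
      \<open>p ^ a * m\<close> with \<open>m\<close> prime to \<open>p\<close>, so it divides
      \<open>p ^ a\<close>, and \<open>M\<close> is \<open>1\<close> modulo it.\<close>
    have "ord x dvd p ^ k" "ord x dvd p ^ a * m"
      using k x pow_order_eq_1[OF x] m(1) by (simp_all add: pow_eq_id a_def)
    moreover have "coprime (p ^ k) m"
      using m(2) p by (simp add: prime_imp_coprime)
    ultimately have "ord x dvd p ^ a"
      by (meson coprime_divisors coprime_dvd_mult_left_iff dvd_refl)
    then have "[M = 1] (mod ord x)"
      using u unfolding M_def by (rule cong_dvd_modulus_nat[rotated])
    then have "[int M = int 1] (mod int (ord x))"
      by (simp only: cong_int_iff)
    then have "x [^] int M = x [^] int 1"
      using x int_pow_eq[of x] by (simp only: cong_iff_dvd_diff dvd_diff_commute)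
    then show ?thesis
      using x by (simp add: int_pow_int)
  qed
  let ?f = "\<lambda>s\<in>carrier G. F (s [^] M)"
  have "?f \<in> semichars G"
    unfolding semichars_def
  proof (intro CollectI conjI ballI impI)
    show "?f \<in> carrier G \<rightarrow>\<^sub>E UNIV - {0}"
      using nz Mp by auto
    fix s t assume st: "s \<in> carrier G" "t \<in> carrier G" "s \<otimes> t = t \<otimes> s"
    then show "?f (s \<otimes> t) = ?f s * ?f t"
      using mult[OF Mp Mp] commuting_nat_pow by (simp add: pow_mult_distrib)
  qed
  moreover have "?f x = F x" if "x \<in> p_elements G p" for x
    using that id by (auto simp: p_elements_def)
  ultimately show ?thesis
    using Mp by (intro bexI[of _ ?f]) auto
qed

text \<open>If both factors have value \<open>1\<close> but the product does not, then both factors commute with the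
  product and hence lie in \<open>S\<close> after all.\<close>
lemma multiplicative_if_commuting_closed:
  fixes F :: "'a \<Rightarrow> complex"
  assumes P: "x \<in> p_elements G p" "y \<in> p_elements G p" and comm: "x \<otimes> y = y \<otimes> x"
    and off: "\<And>x. x \<notin> S \<Longrightarrow> F x = 1"
    and on: "\<And>x y. x \<in> S \<Longrightarrow> y \<in> S \<Longrightarrow> x \<otimes> y \<in> S \<Longrightarrow> F (x \<otimes> y) = F x * F y"
    and closed: "\<And>x y. x \<in> p_elements G p \<Longrightarrow> y \<in> p_elements G p \<Longrightarrow> x \<otimes> y = y \<otimes> x \<Longrightarrow>
      x \<in> S \<Longrightarrow> F x \<noteq> 1 \<Longrightarrow> y \<in> S"
  shows "F (x \<otimes> y) = F x * F y"
proof -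
  have c: "x \<in> carrier G" "y \<in> carrier G"
    using P by (auto simp: p_elements_def)
  have xy: "x \<otimes> y \<in> p_elements G p"
    using P comm by (rule p_elements_mult)
  have comms: "(x \<otimes> y) \<otimes> x = x \<otimes> (x \<otimes> y)" "(x \<otimes> y) \<otimes> y = y \<otimes> (x \<otimes> y)"
    using c comm by (metis m_assoc)+
  consider "F x \<noteq> 1" | "F y \<noteq> 1" | "F (x \<otimes> y) \<noteq> 1" | "F x = 1" "F y = 1" "F (x \<otimes> y) = 1"
    by blast
  then show ?thesis
  proof cases
    case 1
    then have "x \<in> S" "y \<in> S" "x \<otimes> y \<in> S"
      using off closed P comm xy comms by metis+
    then show ?thesis by (rule on)
  next
    case 2
    then have "x \<in> S" "y \<in> S" "x \<otimes> y \<in> S"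
      using off closed P comm xy comms by metis+
    then show ?thesis by (rule on)
  next
    case 3
    then have "x \<in> S" "y \<in> S" "x \<otimes> y \<in> S"
      using off closed P xy comms by metis+
    then show ?thesis by (rule on)
  qed simp
qed

end

section \<open>Powers, \<open>p\<close>-elements and conjugation in the alternating group\<close>

lemma alt_group_nat_pow: "x [^]\<^bsub>alt_group n\<^esub> (k :: nat) = x ^^ k"
  by (induction k) (simp_all add: nat_pow_def alt_group_one alt_group_mult funpow_Suc_right del: funpow.simps(2))

lemma p_elements_alt_group:
  "x \<in> p_elements (alt_group n) p \<longleftrightarrow> x permutes {1..n} \<and> evenperm x \<and> (\<exists>k. x ^^ (p ^ k) = id)"
  by (auto simp: p_elements_def alt_group_carrier alt_group_nat_pow alt_group_one)

lemma p_elements_alt_groupD: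
  assumes "x \<in> p_elements (alt_group n) p"
  shows "x permutes {1..n}" "evenperm x" "\<exists>k. x ^^ (p ^ k) = id"
  using assms by (auto simp: p_elements_alt_group)

text \<open>The permutation \<open>g\<close> may be odd, since conjugation preserves parity. This
  matters because the conjugating permutations chosen later include transpositions.\<close>

lemma conj_alt_group:
  assumes g: "g permutes {1..n}" and s: "s \<in> carrier (alt_group n)"
  shows "inv' g \<circ> s \<circ> g \<in> carrier (alt_group n)"
proof -
  have ps: "s permutes {1..n}" "evenperm s"
    using s by (auto simp: alt_group_carrier)
  have perm: "permutation g" "permutation s" "permutation (inv' g)"
    using g ps by (auto simp: permutation_permutes intro: permutes_inv)
  have "evenperm (inv' g \<circ> s \<circ> g)"
    using perm ps(2) by (simp add: evenperm_comp permutation_compose evenperm_inv)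
  then show ?thesis
    using g ps by (auto simp: alt_group_carrier intro!: permutes_compose permutes_inv)
qed

lemma conj_comp:
  assumes "bij g"
  shows "inv' g \<circ> (s \<circ> t) \<circ> g = (inv' g \<circ> s \<circ> g) \<circ> (inv' g \<circ> t \<circ> g)"
  using assms by (simp add: fun_eq_iff bij_is_surj surj_f_inv_f)

lemma conj_semichars:
  assumes f: "f \<in> semichars (alt_group n)" and g: "g permutes {1..n}"
  shows "(\<lambda>s\<in>carrier (alt_group n). f (inv' g \<circ> s \<circ> g)) \<in> semichars (alt_group n)"
  unfolding semichars_def
proof (intro CollectI conjI ballI impI)
  let ?A = "carrier (alt_group n)"
  show "(\<lambda>s\<in>?A. f (inv' g \<circ> s \<circ> g)) \<in> ?A \<rightarrow>\<^sub>E UNIV - {0}"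
    using semichars_nonzero[OF f conj_alt_group[OF g]] by auto
  have g': "bij g"
    using g by (rule permutes_bij)
  interpret group "alt_group n"
    by (rule alt_group_is_group)
  fix s t
  assume s: "s \<in> ?A" and t: "t \<in> ?A" and "s \<otimes>\<^bsub>alt_group n\<^esub> t = t \<otimes>\<^bsub>alt_group n\<^esub> s"
  then have "s \<circ> t = t \<circ> s"
    by (simp add: alt_group_mult)
  then have "f (inv' g \<circ> (s \<circ> t) \<circ> g) = f (inv' g \<circ> s \<circ> g) * f (inv' g \<circ> t \<circ> g)"
    using semichars_mult[OF f conj_alt_group[OF g s] conj_alt_group[OF g t]]
    by (simp add: alt_group_mult flip: conj_comp[OF g'])
  moreover have "s \<circ> t \<in> ?A"
    using m_closed[OF s t] by (simp add: alt_group_mult)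
  ultimately show "(\<lambda>s\<in>?A. f (inv' g \<circ> s \<circ> g)) (s \<otimes>\<^bsub>alt_group n\<^esub> t) =
      (\<lambda>s\<in>?A. f (inv' g \<circ> s \<circ> g)) s * (\<lambda>s\<in>?A. f (inv' g \<circ> s \<circ> g)) t"
    using s t by (simp add: alt_group_mult)
qed

lemma conj_p_elements_alt_group:
  assumes g: "g permutes {1..n}" and s: "s \<in> p_elements (alt_group n) p"
  shows "inv' g \<circ> s \<circ> g \<in> p_elements (alt_group n) p"
proof -
  obtain k where k: "s ^^ (p ^ k) = id"
    using p_elements_alt_groupD[OF s] by blast
  have g': "bij g"
    using g by (rule permutes_bij)
  have "(inv' g \<circ> s \<circ> g) ^^ i = inv' g \<circ> (s ^^ i) \<circ> g" for i
  proof (induction i)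
    case 0
    then show ?case using g' by (simp add: bij_is_inj)
  next
    case (Suc i)
    then show ?case using conj_comp[OF g', of s "s ^^ i"] by (simp only: funpow.simps)
  qed
  from this[of "p ^ k"] have "(inv' g \<circ> s \<circ> g) ^^ (p ^ k) = id"
    using k g' by (simp add: bij_is_inj)
  moreover have "inv' g \<circ> s \<circ> g \<in> carrier (alt_group n)"
    using g s by (intro conj_alt_group) (auto simp: p_elements_def)
  ultimately show ?thesis
    by (auto simp: p_elements_alt_group alt_group_carrier)
qed

lemma finite_alt_group: "finite (carrier (alt_group n))"
  using finite_permutations[of "{1..n}"] by (rule rev_finite_subset) (auto simp: alt_group_carrier)

text \<open>The conjugates of a single semicharacter by the \<open>g i\<close> serve as the independent family.\<close>
lemma prime_power_dvd_order_semichar_alt_group: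
  fixes F :: "(nat \<Rightarrow> nat) \<Rightarrow> complex"
  assumes p: "prime p"
    and mult: "\<And>x y. x \<in> p_elements (alt_group n) p \<Longrightarrow> y \<in> p_elements (alt_group n) p \<Longrightarrow>
      x \<circ> y = y \<circ> x \<Longrightarrow> F (x \<circ> y) = F x * F y"
    and pow: "\<And>x. F x ^ p = 1"
    and x: "x \<in> p_elements (alt_group n) p" "F x \<noteq> 1"
    and I: "finite I"
    and g: "\<And>i. i \<in> I \<Longrightarrow> g i permutes {1..n}"
    and off_diag: "\<And>i j. i \<in> I \<Longrightarrow> j \<in> I \<Longrightarrow> i \<noteq> j \<Longrightarrow>
      F (inv' (g i) \<circ> (g j \<circ> x \<circ> inv' (g j)) \<circ> g i) = 1"
  shows "p ^ card I dvd order (semichar_group (alt_group n))"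
proof -
  let ?A = "carrier (alt_group n)"
  have nz: "F y \<noteq> 0" for y
    using pow[of y] prime_gt_0_nat[OF p] by (auto simp: power_0_left split: if_splits)
  obtain f where f: "f \<in> semichars (alt_group n)"
    and fF: "\<And>y. y \<in> p_elements (alt_group n) p \<Longrightarrow> f y = F y"
    and range: "f ` ?A \<subseteq> F ` p_elements (alt_group n) p"
    using group.semichar_extension[OF alt_group_is_group finite_alt_group p, of n F] mult nz
    by (auto simp: alt_group_mult)
  have conj_x: "g j \<circ> x \<circ> inv' (g j) \<in> p_elements (alt_group n) p" if "j \<in> I" for j
    using conj_p_elements_alt_group[OF permutes_inv[OF g[OF that]] x(1)] g[OF that]
    by (simp add: permutes_inv_inv)
  have A: "y \<in> ?A" if "y \<in> p_elements (alt_group n) p" for y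
    using that by (simp add: p_elements_def)
  show ?thesis
  proof (rule prime_power_dvd_order_semichar_group[OF alt_group_is_group finite_alt_group p I])
    show "(\<lambda>s\<in>?A. f (inv' (g i) \<circ> s \<circ> g i)) \<in> semichars (alt_group n)" if "i \<in> I" for i
      using conj_semichars[OF f g[OF that]] .
    show "(\<lambda>s\<in>?A. f (inv' (g i) \<circ> s \<circ> g i)) s ^ p = 1" if "i \<in> I" "s \<in> ?A" for i s
    proof -
      have "f (inv' (g i) \<circ> s \<circ> g i) \<in> F ` p_elements (alt_group n) p"
        using range conj_alt_group[OF g that(2)] that(1) by blast
      then show ?thesis
        using that(2) pow by auto
    qed
    show "g i \<circ> x \<circ> inv' (g i) \<in> ?A" if "i \<in> I" for i
      using conj_x[OF that] by (rule A)
    show "(\<lambda>s\<in>?A. f (inv' (g i) \<circ> s \<circ> g i)) (g i \<circ> x \<circ> inv' (g i)) \<noteq> 1" if "i \<in> I" for i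
    proof -
      have "inv' (g i) \<circ> (g i \<circ> x \<circ> inv' (g i)) \<circ> g i = x"
        using permutes_inj[OF g[OF that]] by (simp add: fun_eq_iff)
      then show ?thesis
        using A[OF conj_x[OF that]] fF[OF x(1)] x(2) by simp
    qed
    show "(\<lambda>s\<in>?A. f (inv' (g i) \<circ> s \<circ> g i)) (g j \<circ> x \<circ> inv' (g j)) = 1"
      if "i \<in> I" "j \<in> I" "i \<noteq> j" for i j
      using A[OF conj_x[OF that(2)]] off_diag[OF that]
        fF[OF conj_p_elements_alt_group[OF g[OF that(1)] conj_x[OF that(2)]]] by simp
  qed
qed

section \<open>Rotations of an initial segment\<close>

text \<open>Writing the points of the segment as \<open>Suc x\<close> turns the cycle into addition
  modulo \<open>q\<close> on residues. The exponent \<open>i\<close> is determined only modulo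
  \<open>q\<close>, and behaviour outside the segment is left free.\<close>

definition rot :: "nat \<Rightarrow> nat \<Rightarrow> (nat \<Rightarrow> nat) \<Rightarrow> bool" where
  "rot q i s \<longleftrightarrow> (\<forall>x<q. s (Suc x) = Suc ((x + i) mod q))"

lemma comp_funpow_commute:
  assumes "s \<circ> y = y \<circ> s"
  shows "s ^^ t \<circ> y = y \<circ> s ^^ t"
proof (induction t)
  case (Suc t)
  then show ?case
    using assms by (metis comp_assoc funpow.simps(2))
qed simp

lemma rot_comp:
  assumes "rot q i s" "rot q j t"
  shows "rot q (i + j) (s \<circ> t)"
  unfolding rot_def
proof (intro allI impI)
  fix x assume x: "x < q"
  then have "(s \<circ> t) (Suc x) = s (Suc ((x + j) mod q))"
    using assms(2) by (simp add: rot_def)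
  also have "\<dots> = Suc (((x + j) mod q + i) mod q)"
    using assms(1) x by (simp add: rot_def)
  also have "((x + j) mod q + i) mod q = (x + (i + j)) mod q"
    by (metis add.assoc add.commute mod_add_left_eq)
  finally show "(s \<circ> t) (Suc x) = Suc ((x + (i + j)) mod q)" .
qed

lemma rot_funpow:
  assumes "rot q i s"
  shows "rot q (i * t) (s ^^ t)"
proof (induction t)
  case 0
  then show ?case by (simp add: rot_def)
next
  case (Suc t)
  then show ?case using rot_comp[OF assms Suc] by (simp only: funpow.simps mult_Suc_right)
qed

lemma rot_transitive:
  assumes s: "rot q i s" and i: "coprime i q" and x: "x < q" and y: "y < q"
  obtains t where "(s ^^ t) (Suc x) = Suc y"
proof -
  obtain u where u: "[i * u = 1] (mod q)"
    using cong_solve_coprime_nat[OF i] by auto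
  \<comment> \<open>The required exponent is the inverse \<open>u\<close> of \<open>i\<close> times
    \<open>y - x\<close>; the term \<open>y + (q - x)\<close> represents this difference modulo
    \<open>q\<close> in the naturals.\<close>
  have "[i * (u * (y + (q - x))) = y + (q - x)] (mod q)"
    using cong_scalar_right[OF u, of "y + (q - x)"] by (simp add: mult_ac)
  then have "[x + i * (u * (y + (q - x))) = x + (y + (q - x))] (mod q)"
    by (rule cong_add[OF cong_refl])
  moreover have "x + (y + (q - x)) = y + q"
    using x by simp
  ultimately have "(x + i * (u * (y + (q - x)))) mod q = y"
    using y by (simp add: cong_def)
  then have "(s ^^ (u * (y + (q - x)))) (Suc x) = Suc y"
    using rot_funpow[OF s, of "u * (y + (q - x))"] x by (simp add: rot_def)
  then show thesis
    by (rule that)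
qed

text \<open>Each point of the segment is an image of \<open>1\<close> under a power of
  \<open>s\<close>, so commuting with \<open>s\<close> lets the single value \<open>y 1\<close>
  determine \<open>y\<close> on the whole segment.\<close>

lemma rot_commuting:
  assumes s: "rot q i s" and i: "coprime i q" and comm: "s \<circ> y = y \<circ> s"
    and y: "y 1 \<in> {1..q}"
  shows "\<exists>j. rot q j y"
proof -
  obtain j where j: "y 1 = Suc j" "j < q"
    using y by (intro that[of "y 1 - 1"]) auto
  have "y (Suc x) = Suc ((x + j) mod q)" if x: "x < q" for x
  proof -
    obtain t where t: "(s ^^ t) 1 = Suc x"
      using rot_transitive[OF s i _ x, of 0] j by auto
    have "s ^^ t \<circ> y = y \<circ> s ^^ t"
      by (rule comp_funpow_commute[OF comm])
    then have "y (Suc x) = (s ^^ t) (Suc j)"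
      using t j by (simp add: fun_eq_iff) metis
    also have "\<dots> = Suc ((j + i * t) mod q)"
      using rot_funpow[OF s, of t] j by (simp add: rot_def)
    also have "(j + i * t) mod q = (x + j) mod q"
    proof -
      have "i * t mod q = x"
        using t rot_funpow[OF s, of t] x by (simp add: rot_def)
      then show ?thesis
        by (metis add.commute mod_add_right_eq)
    qed
    finally show ?thesis .
  qed
  then show ?thesis
    by (auto simp: rot_def)
qed

lemma rot_one: "rot q i s \<Longrightarrow> q > 0 \<Longrightarrow> s 1 = Suc (i mod q)"
  unfolding rot_def by (metis One_nat_def add_0)

text \<open>As \<open>p\<close> divides \<open>q\<close>, the power of \<zeta> depends only on
  \<open>i\<close> modulo \<open>q\<close>, which is \<open>s 1 - 1\<close>. The seed value can thus
  be read off from \<open>s 1\<close> without choosing an exponent.\<close>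

lemma rot_root_of_unity:
  fixes \<zeta> :: complex
  assumes "rot q i s" "q > 0" "p dvd q" "\<zeta> ^ p = 1"
  shows "\<zeta> ^ (s 1 - 1) = \<zeta> ^ i"
proof -
  have "\<zeta> ^ q = 1"
    using assms(3,4) by (metis dvd_def power_mult power_one)
  then have "\<zeta> ^ (i mod q) = \<zeta> ^ i"
    by (metis mod_mult_div_eq power_add power_mult power_one mult.right_neutral)
  then show ?thesis
    using rot_one[OF assms(1,2)] by simp
qed

lemma exists_root_of_unity:
  assumes "prime p"
  shows "\<exists>\<zeta> :: complex. \<zeta> ^ p = 1 \<and> \<zeta> \<noteq> 1"
proof -
  have "card {z :: complex. z ^ p = 1} = p" "finite {z :: complex. z ^ p = 1}"
    using prime_gt_0_nat[OF assms] by (auto intro: card_roots_unity_eq finite_roots_unity)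
  moreover have "card {z :: complex. z ^ p = 1} \<le> card {1 :: complex}" if "{z :: complex. z ^ p = 1} \<subseteq> {1}"
    by (rule card_mono[OF _ that]) simp
  ultimately have "\<not> {z :: complex. z ^ p = 1} \<subseteq> {1}"
    using prime_gt_1_nat[OF assms] by (metis card.empty card.insert empty_iff finite.emptyI One_nat_def not_le)
  then show ?thesis
    by blast
qed

text \<open>The seed semicharacter sends \<open>s\<close> to \<open>\<zeta>\<^sup>i\<close> if \<open>s\<close> acts on \<open>{1..q}\<close> as the \<open>i\<close>-th power of the
  cycle \<open>(1 \<dots> q)\<close> and satisfies \<open>Q\<close>, and to \<open>1\<close> otherwise. Its conjugates by the
  transpositions \<open>(3 i)\<close> are told apart by the unique rotation taking \<open>1\<close> to \<open>2\<close>.\<close>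
lemma prime_power_dvd_if_rotation:
  assumes p: "prime p" and q: "q = p ^ k" "k > 0" "q \<ge> 3" "q \<le> n"
    and closed: "\<And>x y i. x \<in> p_elements (alt_group n) p \<Longrightarrow> y \<in> p_elements (alt_group n) p \<Longrightarrow>
      x \<circ> y = y \<circ> x \<Longrightarrow> rot q i x \<Longrightarrow> coprime i q \<Longrightarrow> Q x \<Longrightarrow> y 1 \<in> {1..q} \<and> Q y"
    and seed: "x \<in> p_elements (alt_group n) p" "rot q 1 x" "Q x"
  shows "p ^ (n - 2) dvd order (semichar_group (alt_group n))"
proof -
  obtain \<zeta> :: complex where \<zeta>: "\<zeta> ^ p = 1" "\<zeta> \<noteq> 1"
    using exists_root_of_unity[OF p] by blast
  have pq: "p dvd q" "q > 0"
    using q prime_gt_0_nat[OF p] by (simp_all add: dvd_power)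
  define S where "S = {s. (\<exists>i. rot q i s) \<and> Q s}"
  define F where "F s = (if s \<in> S then \<zeta> ^ (s 1 - 1) else 1)" for s :: "nat \<Rightarrow> nat"
  have F: "F s = \<zeta> ^ i" if "s \<in> S" "rot q i s" for s i
    using that rot_root_of_unity[OF that(2) pq(2,1) \<zeta>(1)] by (simp add: F_def)
  have S_closed: "y \<in> S" if x: "x \<in> p_elements (alt_group n) p" and y: "y \<in> p_elements (alt_group n) p"
    and comm: "x \<circ> y = y \<circ> x" and xS: "x \<in> S" and Fx: "F x \<noteq> 1" for x y
  proof -
    obtain i where i: "rot q i x" "Q x"
      using xS by (auto simp: S_def)
    \<comment> \<open>A seed value other than \<open>1\<close> forces \<open>x\<close> to act as a
      generator of the cycle, which is what \<open>closed\<close> asks for.\<close>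
    have "\<not> p dvd i"
    proof
      assume "p dvd i"
      then obtain c where "i = p * c" ..
      then have "\<zeta> ^ i = 1"
        using \<zeta>(1) by (simp add: power_mult)
      then show False
        using F[OF xS i(1)] Fx by simp
    qed
    then have "coprime p i"
      using p by (simp add: prime_imp_coprime)
    then have cop: "coprime i q"
      unfolding q(1) by (simp add: coprime_commute)
    then have "y 1 \<in> {1..q}" "Q y"
      using closed[OF x y comm i(1) _ i(2)] by auto
    then show ?thesis
      using rot_commuting[OF i(1) cop comm] by (auto simp: S_def)
  qed
  interpret group "alt_group n"
    by (rule alt_group_is_group)
  \<comment> \<open>The index \<open>3\<close> stands for the identity, the degenerate
    transposition, so there are \<open>n - 2\<close> conjugates.\<close>
  have "p ^ card {3..n} dvd order (semichar_group (alt_group n))"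
  proof (rule prime_power_dvd_order_semichar_alt_group[where F = F and x = x and g = "\<lambda>i. transpose 3 i"])
    show "F (x \<circ> y) = F x * F y"
      if "x \<in> p_elements (alt_group n) p" "y \<in> p_elements (alt_group n) p" "x \<circ> y = y \<circ> x" for x y
    proof (rule multiplicative_if_commuting_closed[where S = S, unfolded alt_group_mult, OF that])
      show "F s = 1" if "s \<notin> S" for s
        using that by (simp add: F_def)
      show "F (s \<circ> t) = F s * F t" if st: "s \<in> S" "t \<in> S" "s \<circ> t \<in> S" for s t
      proof -
        obtain i j where ij: "rot q i s" "rot q j t"
          using st by (auto simp: S_def)
        then show ?thesis
          using F[OF st(1) ij(1)] F[OF st(2) ij(2)] F[OF st(3) rot_comp[OF ij]]
          by (simp add: power_add)
      qed
    qed (rule S_closed)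
    show "F s ^ p = 1" for s
    proof -
      have "(\<zeta> ^ m) ^ p = (\<zeta> ^ p) ^ m" for m
        by (simp only: power_mult[symmetric] mult.commute)
      then show ?thesis
        using \<zeta>(1) by (simp add: F_def)
    qed
    have "x \<in> S"
      using seed by (auto simp: S_def)
    then show "F x \<noteq> 1"
      using F[OF _ seed(2)] \<zeta>(2) by simp
    show "transpose 3 i permutes {1..n}" if "i \<in> {3..n}" for i
      using that by (intro permutes_swap_id) auto
    fix i j assume ij: "i \<in> {3..n}" "j \<in> {3..n}" "i \<noteq> j"
    \<comment> \<open>The transpositions fix \<open>1\<close> and \<open>2\<close>, and
      \<open>x\<close> sends \<open>1\<close> to \<open>2\<close> to \<open>3\<close>. So
      \<open>y\<close> sends \<open>1\<close> to \<open>2\<close>, but \<open>2\<close> to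
      \<open>transpose 3 i j\<close>, which differs from \<open>3\<close>; a rotation taking
      \<open>1\<close> to \<open>2\<close> would take \<open>2\<close> to \<open>3\<close>.\<close>
    define y where "y = inv' (transpose 3 i) \<circ> (transpose 3 j \<circ> x \<circ> inv' (transpose 3 j)) \<circ> transpose 3 i"
    have inv: "inv' (transpose (3 :: nat) l) = transpose 3 l" for l
      by (rule inv_unique_comp) simp_all
    have "x (Suc 0) = Suc ((0 + 1) mod q)" "x (Suc 1) = Suc ((1 + 1) mod q)"
      using seed(2) q(3) unfolding rot_def by auto
    then have x12: "x 1 = 2" "x 2 = 3"
      using q(3) by (simp_all add: numeral_2_eq_2)
    have tr: "transpose 3 l 1 = 1" "transpose 3 l 2 = 2" if "l \<in> {3..n}" for l
      using that by (auto simp: transpose_def)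
    have y1: "y 1 = 2"
      unfolding y_def inv comp_apply tr[OF ij(1)] tr[OF ij(2)] x12 ..
    have y2: "y 2 = transpose 3 i j"
      unfolding y_def inv comp_apply tr[OF ij(1)] tr[OF ij(2)] x12 by simp
    have "F y = 1"
    proof (rule ccontr)
      assume "F y \<noteq> 1"
      then obtain l where l: "rot q l y"
        by (auto simp: F_def S_def split: if_splits)
      have l1: "l mod q = 1"
        using rot_one[OF l pq(2)] y1 by simp
      have "y (Suc 1) = Suc ((1 + l) mod q)"
        using l q(3) unfolding rot_def by auto
      also have "(1 + l) mod q = (1 + l mod q) mod q"
        by (simp only: mod_add_right_eq)
      also have "\<dots> = 2"
        using q(3) by (simp add: l1)
      finally have "y 2 = 3"
        by (simp add: numeral_2_eq_2)
      then show False
        using y2 ij by (auto simp: transpose_def split: if_splits)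
    qed
    then show "F (inv' (transpose 3 i) \<circ> (transpose 3 j \<circ> x \<circ> inv' (transpose 3 j)) \<circ> transpose 3 i) = 1"
      unfolding y_def .
  qed (use p seed in auto)
  moreover have "card {3..n} = n - 2"
    by simp
  ultimately show ?thesis
    by simp
qed

section \<open>The cycle (1 2 ... q) as a product of adjacent transpositions\<close>

fun cyc :: "nat \<Rightarrow> nat \<Rightarrow> nat" where
  "cyc 0 = id"
| "cyc (Suc 0) = id"
| "cyc (Suc (Suc q)) = cyc (Suc q) \<circ> transpose (Suc q) (Suc (Suc q))"

lemma cyc_permutes: "cyc q permutes {1..q}"
proof (induction q rule: cyc.induct)
  case (3 q)
  have "cyc (Suc q) permutes {1..Suc (Suc q)}"
    by (rule permutes_subset[OF 3]) auto
  moreover have "transpose (Suc q) (Suc (Suc q)) permutes {1..Suc (Suc q)}"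
    by (rule permutes_swap_id) auto
  ultimately show ?case
    unfolding cyc.simps by (intro permutes_compose)
qed (auto simp: permutes_id)

lemma sign_cyc: "sign (cyc (Suc q)) = (- 1) ^ q"
proof (induction q)
  case (Suc q)
  have "permutation (cyc (Suc q))"
    using cyc_permutes permutation_permutes by blast
  then show ?case
    unfolding cyc.simps using Suc by (subst sign_compose) (simp_all add: permutation_swap_id sign_swap_id)
qed (simp add: sign_id)

lemma cyc_apply: "x < q \<Longrightarrow> cyc q (Suc x) = Suc (Suc x mod q)"
proof (induction q arbitrary: x rule: cyc.induct)
  case (3 q)
  consider "x < q" | "x = q" | "x = Suc q"
    using 3(2) by linarith
  then show ?case
  proof cases
    case 1
    then have "cyc (Suc q) (Suc x) = Suc (Suc x)"
      using 3(1)[of x] by simp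
    then show ?thesis using 1 by (simp add: transpose_def)
  next
    case 2
    have "cyc (Suc q) (Suc (Suc q)) = Suc (Suc q)"
      by (rule permutes_not_in[OF cyc_permutes]) simp
    with 2 show ?thesis by simp
  next
    case 3
    have "cyc (Suc q) (Suc q) = Suc 0"
      using "3.IH"[of q] by simp
    then show ?thesis using 3 by simp
  qed
qed simp_all

lemma rot_cyc: "rot q 1 (cyc q)"
  using cyc_apply by (simp add: rot_def)

lemma cyc_outside: "x \<notin> {1..q} \<Longrightarrow> cyc q x = x"
  using permutes_not_in[OF cyc_permutes] .

lemma funpow_fixed: "f x = x \<Longrightarrow> (f ^^ k) x = x"
  by (induction k) auto

lemma rot_funpow_period:
  assumes "rot q i s" "x \<in> {1..q}"
  shows "(s ^^ q) x = x"
proof -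
  obtain y where y: "x = Suc y" "y < q"
    using assms(2) by (cases x) auto
  then have "(s ^^ q) (Suc y) = Suc ((y + i * q) mod q)"
    using rot_funpow[OF assms(1), of q] unfolding rot_def by blast
  moreover have "(y + i * q) mod q = y"
    using y(2) by simp
  ultimately show ?thesis
    unfolding y(1) by (simp only:)
qed

lemma cyc_funpow: "cyc q ^^ q = id"
proof
  fix x
  show "(cyc q ^^ q) x = id x"
  proof (cases "x \<in> {1..q}")
    case True
    then show ?thesis using rot_funpow_period[OF rot_cyc] by simp
  next
    case False
    then show ?thesis using funpow_fixed[of "cyc q" x q] cyc_outside[of x q] by simp
  qed
qed

section \<open>Odd primes\<close>

lemma funpow_permutes_inj: "y permutes A \<Longrightarrow> inj (y ^^ k)"
  by (simp add: permutes_inj inj_fn)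

text \<open>If \<open>y\<close> moved the block \<open>{1..q}\<close>, its first \<open>p\<close> translates would be disjoint.\<close>
lemma rot_commuting_block:
  assumes p: "prime p" and n: "q \<le> n" "n < p * q" and rot: "rot q i x" and i: "coprime i q"
    and y: "y permutes {1..n}" "y ^^ (p ^ a) = id" and comm: "x \<circ> y = y \<circ> x"
  shows "y 1 \<in> {1..q}"
proof (rule ccontr)
  assume y1: "y 1 \<notin> {1..q}"
  have q0: "q > 0"
    using n by (cases q) auto
  \<comment> \<open>Powers of \<open>x\<close> are transitive on the block and commute with
    \<open>y ^^ d\<close>. Hence if \<open>y ^^ d\<close> keeps one point in the block, it keeps all
    of them there.\<close>
  have transfer: "(y ^^ d) w \<in> {1..q}"
    if zw: "z \<in> {1..q}" "w \<in> {1..q}" and yz: "(y ^^ d) z \<in> {1..q}" for d z w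
  proof -
    obtain z' w' where z': "z = Suc z'" "z' < q" and w': "w = Suc w'" "w' < q"
      using zw by (cases z; cases w) auto
    obtain t where t: "(x ^^ t) z = w"
      using rot_transitive[OF rot i z'(2) w'(2)] z'(1) w'(1) by metis
    have "x ^^ t \<circ> y ^^ d = y ^^ d \<circ> x ^^ t"
      using comp_funpow_commute comm by metis
    then have "(y ^^ d) w = (x ^^ t) ((y ^^ d) z)"
      using t by (metis comp_apply)
    moreover obtain v where v: "(y ^^ d) z = Suc v" "v < q"
      using yz by (cases "(y ^^ d) z") auto
    moreover have "(x ^^ t) (Suc v) = Suc ((v + i * t) mod q)"
      using rot_funpow[OF rot, of t] v(2) by (simp only: rot_def)
    moreover have "(v + i * t) mod q < q"
      using q0 by simp
    ultimately show ?thesis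
      using atLeastAtMost_iff by (metis Suc_le_eq One_nat_def Suc_le_mono zero_le)
  qed
  \<comment> \<open>As \<open>d\<close> is invertible modulo \<open>p ^ a\<close>, \<open>y\<close>
    is a power of \<open>y ^^ d\<close>; a return to the block would therefore keep
    \<open>y 1\<close> in it.\<close>
  have no_return: "(y ^^ d) z \<notin> {1..q}" if z: "z \<in> {1..q}" and d: "0 < d" "d < p" for d z
  proof
    assume yz: "(y ^^ d) z \<in> {1..q}"
    have one: "1 \<in> {1..q}"
      using q0 by simp
    have mult: "(y ^^ (d * u)) 1 \<in> {1..q}" for u
    proof (induction u)
      case (Suc u)
      then have "(y ^^ d) ((y ^^ (d * u)) 1) \<in> {1..q}"
        using transfer[OF z _ yz] by blast
      then show ?case
        by (simp add: funpow_add)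
    qed (use one in simp)
    have "\<not> p dvd d"
      using d by (auto dest: dvd_imp_le)
    then have "coprime p d"
      using p by (simp add: prime_imp_coprime)
    then have "coprime d (p ^ a)"
      by (simp add: coprime_commute)
    then obtain u where "[d * u = 1] (mod p ^ a)"
      using cong_solve_coprime_nat[of d "p ^ a"] by (metis One_nat_def)
    then have "(y ^^ (d * u mod p ^ a)) 1 = (y ^^ (1 mod p ^ a)) 1"
      by (simp only: cong_def)
    moreover have "(y ^^ (m mod p ^ a)) 1 = (y ^^ m) 1" for m
      using y(2) by (intro funpow_mod_eq) simp
    ultimately have "(y ^^ 1) 1 = (y ^^ (d * u)) 1"
      by metis
    then have "y 1 \<in> {1..q}"
      using mult[of u] by simp
    then show False
      using y1 by contradiction
  qed
  \<comment> \<open>Disjointness of the translates yields \<open>p * q\<close> distinct points of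
    \<open>{1..n}\<close>, against \<open>n < p * q\<close>.\<close>
  have "inj_on (\<lambda>(u, z). (y ^^ u) z) ({..<p} \<times> {1..q})"
  proof -
    have *: False if "u < u'" "u' < p" "z \<in> {1..q}" "z' \<in> {1..q}" "(y ^^ u) z = (y ^^ u') z'" for u u' z z'
    proof -
      have "(y ^^ u') z' = (y ^^ u) ((y ^^ (u' - u)) z')"
        using that(1) by (metis add_diff_inverse_nat comp_apply funpow_add less_imp_not_less)
      then have "(y ^^ (u' - u)) z' = z"
        using that(5) funpow_permutes_inj[OF y(1), of u] by (metis injD)
      moreover have "0 < u' - u" "u' - u < p"
        using that(1,2) by linarith+
      ultimately show False
        using no_return[OF that(4), of "u' - u"] that(3) by simp
    qed
    show ?thesis
    proof (rule inj_onI)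
      fix a b
      assume ab: "a \<in> {..<p} \<times> {1..q}" "b \<in> {..<p} \<times> {1..q}"
        "(case a of (u, z) \<Rightarrow> (y ^^ u) z) = (case b of (u, z) \<Rightarrow> (y ^^ u) z)"
      obtain u z u' z' where uz: "a = (u, z)" "b = (u', z')"
        by (cases a; cases b)
      then have eq: "(y ^^ u) z = (y ^^ u') z'"
        and "u \<in> {..<p}" "u' \<in> {..<p}" "z \<in> {1..q}" "z' \<in> {1..q}"
        using ab by auto
      then have "u = u'"
        using *[of u u' z z'] *[of u' u z' z] by (metis lessThan_iff linorder_neqE_nat)
      then show "a = b"
        using eq uz funpow_permutes_inj[OF y(1), of u] by (metis injD)
    qed
  qed
  then have "card ({..<p} \<times> {1..q}) \<le> card {1..n}"
  proof (rule card_inj_on_le)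
    show "(\<lambda>(u, z). (y ^^ u) z) ` ({..<p} \<times> {1..q}) \<subseteq> {1..n}"
      using permutes_in_image[OF permutes_funpow[OF y(1)]] n by fastforce
  qed simp
  then show False
    using n by (simp add: card_cartesian_product)
qed

lemma sign_funpow: "permutation f \<Longrightarrow> sign (f ^^ k) = sign f ^ k"
proof (induction k)
  case (Suc k)
  have "permutation (f ^^ k)"
    using Suc.prems by (induction k) (simp_all add: permutation_compose)
  then show ?case
    using Suc unfolding funpow.simps by (subst sign_compose) simp_all
qed (simp add: sign_id)

lemma cyc_even_iff: "q > 0 \<Longrightarrow> evenperm (cyc q) \<longleftrightarrow> odd q"
proof (cases q)
  case (Suc m)
  then show ?thesis
    using sign_cyc[of m] by (cases "even m") (auto simp: sign_def split: if_splits)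
qed simp

text \<open>Maximality of the power \<open>q\<close> gives the bound \<open>n < p * q\<close> of the
  block argument. Since \<open>q\<close> is odd, the cycle itself is even and can be the seed, with
  no further condition \<open>Q\<close>.\<close>

lemma odd_prime_power_dvd_order_semichar_alt_group:
  assumes p: "prime p" "odd p" "p \<le> n"
  shows "p ^ (n - 2) dvd order (semichar_group (alt_group n))"
proof -
  have p1: "p > 1"
    using p(1) by (rule prime_gt_1_nat)
  then have p3: "p \<ge> 3"
    using p(2) by (cases "p = 2") auto
  obtain k where k: "p ^ k \<le> n" "n < p ^ (k + 1)"
    using ex_power_ivl1[of p n] p1 p3 p(3) by auto
  then have "k > 0"
    using p(3) by (cases k) auto
  define q where "q = p ^ k"
  have "odd q"
    using p(2) by (simp add: q_def)
  have "p ^ 1 \<le> q"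
    unfolding q_def using \<open>k > 0\<close> p1 by (intro power_increasing) auto
  show ?thesis
  proof (rule prime_power_dvd_if_rotation[where q = q and x = "cyc q" and Q = "\<lambda>_. True"])
    show "3 \<le> q" "q \<le> n" "q = p ^ k" "k > 0"
      using \<open>p ^ 1 \<le> q\<close> p3 k \<open>k > 0\<close> by (simp_all add: q_def)
    then show "cyc q \<in> p_elements (alt_group n) p"
      using cyc_funpow[of q] cyc_even_iff[of q] \<open>odd q\<close> permutes_subset[OF cyc_permutes, of q "{1..n}"]
      by (auto simp: p_elements_alt_group)
    show "rot q 1 (cyc q)"
      by (rule rot_cyc)
    fix x y i
    assume "x \<in> p_elements (alt_group n) p" and y: "y \<in> p_elements (alt_group n) p"
      and xy: "x \<circ> y = y \<circ> x" "rot q i x" "coprime i q"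
    obtain a where a: "y ^^ (p ^ a) = id"
      using p_elements_alt_groupD(3)[OF y] by blast
    show "y 1 \<in> {1..q} \<and> True"
      using rot_commuting_block[OF p(1) \<open>q \<le> n\<close> _ xy(2,3) p_elements_alt_groupD(1)[OF y] a xy(1)] k(2)
      by (simp add: q_def)
  qed (use p in auto)
qed

section \<open>The prime two\<close>

text \<open>The set \<open>S\<close> has at most one point, and the values taken off
  \<open>S\<close> are the same for both bijections, so the one value left over is forced.\<close>

lemma bij_eq_if_eq_off_one:
  assumes "bij f" "bij g" and eq: "\<And>x. x \<notin> S \<Longrightarrow> f x = g x"
    and S: "\<And>x y. x \<in> S \<Longrightarrow> y \<in> S \<Longrightarrow> x = y"
  shows "f = g"
proof
  fix w
  obtain v where v: "f v = g w"
    using bij_is_surj[OF assms(1)] by (metis surjD)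
  show "f w = g w"
  proof (cases "v \<in> S \<and> w \<in> S")
    case True
    then show ?thesis using S v by blast
  next
    case False
    then show ?thesis using eq v bij_is_inj[OF assms(2)] by (metis injD)
  qed
qed

text \<open>Assume \<open>y\<close> has an orbit \<open>Z\<close> of length at least \<open>q\<close> outside \<open>{1..q}\<close>. Then \<open>x\<close> acts on
  \<open>Z\<close> as \<open>y\<^sup>l\<close> with \<open>l\<close> even, hence \<open>x \<circ> cyc\<^sup>j\<^sup>l = y\<^sup>l \<circ> cyc\<^sup>i\<close>, contradicting the signs.\<close>
lemma rot_commuting_even_outside:
  assumes q: "q = 2 * h" "q = 2 ^ k" and n: "n \<le> 2 * q + 1"
    and x: "x permutes {1..n}" "evenperm x" and rot: "rot q i x" "odd i"
    and x_out: "\<And>z. z \<notin> {1..q} \<Longrightarrow> (x ^^ h) z = z"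
    and y: "y permutes {1..n}" "y ^^ (2 ^ a) = id" "rot q j y" and comm: "x \<circ> y = y \<circ> x"
    and z: "z \<notin> {1..q}"
  shows "(y ^^ h) z = z"
proof (rule ccontr)
  assume yz: "(y ^^ h) z \<noteq> z"
  have q0: "q > 0"
    using q(2) by simp
  have comm': "x (y w) = y (x w)" for w
    using comm by (metis comp_apply)
  have commpow: "x ((y ^^ m) w) = (y ^^ m) (x w)" for m w
    using comp_funpow_commute[OF comm[symmetric], of m] by (metis comp_apply)
  have x_in: "x w \<in> {1..q} \<longleftrightarrow> w \<in> {1..q}" and y_in: "y w \<in> {1..q} \<longleftrightarrow> w \<in> {1..q}" for w
  proof -
    have moved: "f w \<in> {1..q} \<longleftrightarrow> w \<in> {1..q}" if f: "f permutes {1..n}" and r: "rot q m f" for f m w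
    proof -
      have sub: "f ` {1..q} \<subseteq> {1..q}"
      proof (rule image_subsetI)
        fix v assume "v \<in> {1..q}"
        then obtain v' where v': "v = Suc v'" "v' < q"
          by (cases v) auto
        have "f (Suc v') = Suc ((v' + m) mod q)"
          using r v'(2) by (simp only: rot_def)
        moreover have "(v' + m) mod q < q"
          using q0 by simp
        ultimately show "f v \<in> {1..q}"
          using v'(1) by simp
      qed
      have "f ` {1..q} = {1..q}"
        using sub permutes_inj[OF f] by (intro endo_inj_surj) (auto intro: inj_on_subset)
      then show ?thesis
        using permutes_inj[OF f] by (metis inj_image_mem_iff)
    qed
    show "x w \<in> {1..q} \<longleftrightarrow> w \<in> {1..q}"
      by (rule moved[OF x(1) rot(1)])
    show "y w \<in> {1..q} \<longleftrightarrow> w \<in> {1..q}"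
      by (rule moved[OF y(1,3)])
  qed
  define R where "R = {1..n} - {1..q}"
  have R: "finite R" "card R \<le> q + 1"
    using n by (auto simp: R_def card_Diff_subset_Int)
  have x_R: "x w \<in> R \<longleftrightarrow> w \<in> R" and y_R: "y w \<in> R \<longleftrightarrow> w \<in> R" for w
    using x_in y_in permutes_in_image[OF x(1)] permutes_in_image[OF y(1)] unfolding R_def by blast+
  have zR: "z \<in> R"
  proof (rule ccontr)
    assume "z \<notin> R"
    then have "y z = z"
      using z permutes_not_in[OF y(1)] by (auto simp: R_def)
    then show False
      using yz funpow_fixed by metis
  qed
  have perm_y: "permutation y"
    using y(1) permutation_permutes by blast
  define L where "L = least_power y z"
  have L_dvd: "L dvd m \<longleftrightarrow> (y ^^ m) z = z" for m
    unfolding L_def by (rule least_power_dvd[OF perm_y])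
  have "L dvd 2 ^ a"
    using L_dvd y(2) by simp
  then obtain e where e: "L = 2 ^ e"
    using divides_primepow_nat[OF two_is_prime_nat] by blast
  have "k > 0"
    using q by (cases k) auto
  \<comment> \<open>The orbit length \<open>L\<close> is a power of two that does not divide
    \<open>h\<close>, half of \<open>q\<close>; so \<open>q\<close> divides
    \<open>L\<close>.\<close>
  have "k \<le> e"
  proof (rule ccontr)
    assume "\<not> k \<le> e"
    then have "(2 :: nat) ^ e dvd 2 ^ (k - 1)"
      by (intro le_imp_power_dvd) auto
    also have "(2 :: nat) ^ (k - 1) = h"
      using q \<open>k > 0\<close> by (cases k) auto
    finally show False
      using L_dvd[of h] e yz by simp
  qed
  then have qL: "q dvd L"
    using e q(2) by (simp add: le_imp_power_dvd)
  have L0: "L > 0"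
    using e by simp
  define Z where "Z = (\<lambda>u. (y ^^ u) z) ` {..<L}"
  have Z: "(y ^^ u) z \<in> Z" for u
  proof -
    have "(y ^^ (u mod L)) z = (y ^^ u) z"
      using L_dvd[of L] by (intro funpow_mod_eq) simp
    then show ?thesis
      using L0 unfolding Z_def by (metis image_eqI lessThan_iff mod_less_divisor)
  qed
  have Z_R: "Z \<subseteq> R"
  proof -
    have "(y ^^ u) z \<in> R" for u
      using zR y_R by (induction u) auto
    then show ?thesis
      by (auto simp: Z_def)
  qed
  have card_Z: "card Z = L"
  proof -
    have *: False if "u < u'" "u' < L" "(y ^^ u) z = (y ^^ u') z" for u u'
    proof -
      have "(y ^^ u') z = (y ^^ u) ((y ^^ (u' - u)) z)"
        using that(1) by (metis add_diff_inverse_nat comp_apply funpow_add less_imp_not_less)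
      then have "(y ^^ (u' - u)) z = z"
        using that(3) funpow_permutes_inj[OF y(1), of u] by (metis injD)
      then have "L dvd u' - u"
        using L_dvd by simp
      then show False
        using that by (auto dest: dvd_imp_le)
    qed
    have "inj_on (\<lambda>u. (y ^^ u) z) {..<L}"
    proof (rule inj_onI)
      fix u u' assume "u \<in> {..<L}" "u' \<in> {..<L}" "(y ^^ u) z = (y ^^ u') z"
      then show "u = u'"
        using *[of u u'] *[of u' u] by (metis lessThan_iff linorder_neqE_nat)
    qed
    then show ?thesis
      by (simp add: Z_def card_image)
  qed
  \<comment> \<open>Outside the block at most \<open>q + 1\<close> points of \<open>{1..n}\<close>
    remain, and the orbit \<open>Z\<close> uses at least \<open>q\<close> of them.\<close>
  have "finite Z" "card Z \<ge> q"
    using card_Z qL L0 by (auto simp: Z_def dvd_imp_le)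
  then have RZ: "card (R - Z) \<le> 1"
    using R Z_R by (simp add: card_Diff_subset)
  have single: "v = w" if "v \<in> R - Z" "w \<in> R - Z" for v w
    using RZ that R(1) card_le_Suc0_iff_eq[of "R - Z"] by auto
  \<comment> \<open>Otherwise \<open>x z\<close> is the only point left over, so \<open>y\<close>
    fixes it; by commutation \<open>y\<close> would then fix \<open>z\<close>.\<close>
  have "x z \<in> Z"
  proof (rule ccontr)
    assume xz: "x z \<notin> Z"
    have "y (x z) \<notin> Z"
    proof
      assume "y (x z) \<in> Z"
      then obtain u where "y (x z) = (y ^^ u) z"
        by (auto simp: Z_def)
      also have "(y ^^ u) z = (y ^^ u) ((y ^^ L) z)"
        using L_dvd[of L] by simp
      also have "\<dots> = (y ^^ Suc (u + L - 1)) z"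
        using L0 by (metis add_gr_0 comp_apply funpow_add Suc_diff_1)
      finally have "x z = (y ^^ (u + L - 1)) z"
        using permutes_inj[OF y(1)] by (simp add: inj_eq)
      then show False
        using xz Z by simp
    qed
    then have "y (x z) = x z"
      using single xz zR x_R y_R by blast
    then have "y z = z"
      using comm'[of z] permutes_inj[OF x(1)] by (simp add: inj_eq)
    then show False
      using yz funpow_fixed by metis
  qed
  then obtain l where l: "x z = (y ^^ l) z"
    by (auto simp: Z_def)
  have xZ: "x w = (y ^^ l) w" if "w \<in> Z" for w
  proof -
    obtain u where u: "w = (y ^^ u) z"
      using \<open>w \<in> Z\<close> by (auto simp: Z_def)
    then have "x w = (y ^^ u) ((y ^^ l) z)"
      using commpow l by simp
    also have "\<dots> = (y ^^ l) ((y ^^ u) z)"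
      by (metis add.commute comp_apply funpow_add)
    finally show ?thesis
      using u by simp
  qed
  \<comment> \<open>On \<open>Z\<close> the map \<open>x ^^ h\<close> is \<open>y ^^ (l * h)\<close>
    and fixes \<open>z\<close>, so \<open>q = 2 * h\<close> divides \<open>l * h\<close>.\<close>
  have "even l"
  proof -
    have "(x ^^ m) z = (y ^^ (l * m)) z" for m
    proof (induction m)
      case (Suc m)
      have "(x ^^ Suc m) z = (y ^^ l) ((y ^^ (l * m)) z)"
        using Suc xZ[OF Z] by simp
      then show ?case
        by (simp add: funpow_add)
    qed simp
    then have "(y ^^ (l * h)) z = z"
      using x_out[OF z] by metis
    then have "q dvd l * h"
      using L_dvd qL by (metis dvd_trans)
    then show ?thesis
      using q(1) q0 by simp
  qed
  \<comment> \<open>Both maps rotate the block by \<open>i + j * l\<close>, and on \<open>Z\<close>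
    both act as \<open>x\<close>. They agree off \<open>R - Z\<close>, hence everywhere; but
    \<open>?A\<close> is even because \<open>l\<close> is even, while \<open>?B\<close> is odd
    because \<open>i\<close> is odd.\<close>
  let ?A = "x \<circ> cyc q ^^ (j * l)" and ?B = "y ^^ l \<circ> cyc q ^^ i"
  have perm_c: "permutation (cyc q)"
    using cyc_permutes permutation_permutes by blast
  have perm_x: "permutation x"
    using x(1) permutation_permutes by blast
  have perm_pow: "permutation (f ^^ m)" if "permutation f" for f :: "nat \<Rightarrow> nat" and m
    using that by (induction m) (simp_all only: funpow.simps permutation_id permutation_compose)
  have "?A w = ?B w" if w: "w \<notin> R - Z" for w
  proof (cases "w \<in> {1..q}")
    case True
    have "rot q (i + 1 * (j * l)) ?A"
      by (rule rot_comp[OF rot(1) rot_funpow[OF rot_cyc]])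
    moreover have "rot q (j * l + 1 * i) ?B"
      by (rule rot_comp[OF rot_funpow[OF y(3)] rot_funpow[OF rot_cyc]])
    moreover obtain v where "w = Suc v" "v < q"
      using True by (cases w) auto
    ultimately show ?thesis
      unfolding rot_def by (simp only: mult_1 add.commute)
  next
    case False
    then have fixed: "(cyc q ^^ m) w = w" for m
      using funpow_fixed[of "cyc q" w m] cyc_outside[of w q] by simp
    have "x w = (y ^^ l) w"
    proof (cases "w \<in> Z")
      case False
      then have "w \<notin> {1..n}"
        using w \<open>w \<notin> {1..q}\<close> by (auto simp: R_def)
      then show ?thesis
        using permutes_not_in[OF x(1)] permutes_not_in[OF permutes_funpow[OF y(1)]] by simp
    qed (rule xZ)
    then show ?thesis
      by (simp add: fixed)
  qed
  moreover have "bij ?A" "bij ?B"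
    using perm_c perm_x perm_y perm_pow
    by (auto intro!: permutation_bijective permutation_compose)
  ultimately have "?A = ?B"
    using single by (intro bij_eq_if_eq_off_one[where S = "R - Z"])
  then have "sign ?A = sign ?B"
    by simp
  then have "sign x * sign (cyc q) ^ (j * l) = sign y ^ l * sign (cyc q) ^ i"
    using perm_x perm_y perm_c perm_pow by (simp only: sign_compose sign_funpow)
  moreover have "sign (cyc q) = - 1"
    using sign_cyc[of "q - 1"] q(1) q0 by (cases q) auto
  moreover have "sign y ^ l = 1"
    using \<open>even l\<close> by (auto simp: sign_def)
  ultimately show False
    using x(2) \<open>even l\<close> rot(2) by (simp add: sign_def)
qed

lemma two_power_dvd_order_semichar_alt_group:
  assumes n: "n \<ge> 6"
  shows "2 ^ (n - 2) dvd order (semichar_group (alt_group n))"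
proof -
  obtain k where k: "2 ^ k \<le> n - 2" "n - 2 < 2 ^ (k + 1)"
  proof -
    have "1 \<le> n - 2"
      using n by linarith
    then show thesis
      using ex_power_ivl1[of 2 "n - 2"] that by auto
  qed
  have k2: "k \<ge> 2"
  proof (rule ccontr)
    assume "\<not> k \<ge> 2"
    then have "(2 :: nat) ^ (k + 1) \<le> 2 ^ 2"
      by (intro power_increasing) auto
    then show False
      using k n by simp
  qed
  define q h where "q = (2 :: nat) ^ k" and "h = (2 :: nat) ^ (k - 1)"
  have qh: "q = 2 * h"
    using k2 by (cases k) (auto simp: q_def h_def)
  have "(2 :: nat) ^ 2 \<le> q"
    unfolding q_def using k2 by (intro power_increasing) auto
  then have q4: "q \<ge> 4"
    by simp
  have nq: "q + 2 \<le> n" "n \<le> 2 * q + 1"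
    using k n by (simp_all add: q_def)
  have h_even: "even h"
    using k2 by (simp add: h_def)
  \<comment> \<open>A \<open>q\<close>-cycle is odd here; the extra transposition makes the seed
    even, which is why \<open>q + 2\<close> must not exceed \<open>n\<close>.\<close>
  define x where "x = cyc q \<circ> transpose (q + 1) (q + 2)"
  \<comment> \<open>For a 2-element preserving the block, this excludes cycles of length
    \<open>q\<close> or more outside it. The seed satisfies it because \<open>h\<close> is even,
    which uses \<open>q\<close> at least \<open>4\<close> and hence \<open>n\<close> at least
    \<open>6\<close>.\<close>
  define Q where "Q y \<longleftrightarrow> (\<forall>z. z \<notin> {1..q} \<longrightarrow> (y ^^ h) z = z)" for y :: "nat \<Rightarrow> nat"
  have rot_x: "rot q 1 x"
    using rot_cyc[of q] by (auto simp: rot_def x_def transpose_def)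
  have x2: "x (x z) = z" if "z \<notin> {1..q}" for z
  proof -
    have out: "cyc q w = w" if "w \<notin> {1..q}" for w
      using that by (rule cyc_outside)
    have "x w = transpose (q + 1) (q + 2) w" if "w \<notin> {1..q}" for w
      using that out[of w] out[of "q + 1"] out[of "q + 2"] by (simp add: x_def transpose_def)
    moreover have "transpose (q + 1) (q + 2) z \<notin> {1..q}"
      using that by (auto simp: transpose_def)
    ultimately show ?thesis
      using that by simp
  qed
  have x_even: "(x ^^ (2 * m)) z = z" if "z \<notin> {1..q}" for z m
    using x2[OF that] by (induction m) simp_all
  have "Q x"
    using h_even x_even by (auto simp: Q_def elim!: evenE)
  have x_per: "x ^^ (2 ^ k) = id"
  proof
    fix z
    have "(x ^^ q) z = z"
      using rot_funpow_period[OF rot_x, of z] x_even[of z h] qh by (cases "z \<in> {1..q}") auto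
    then show "(x ^^ (2 ^ k)) z = id z"
      by (simp add: q_def)
  qed
  have x_perm: "x permutes {1..n}"
    unfolding x_def
  proof (rule permutes_compose)
    show "cyc q permutes {1..n}"
      using nq by (intro permutes_subset[OF cyc_permutes]) auto
    show "transpose (q + 1) (q + 2) permutes {1..n}"
      using nq by (intro permutes_swap_id) auto
  qed
  have "permutation (cyc q)"
    using cyc_permutes permutation_permutes by blast
  moreover have "sign (cyc q) = - 1"
    using sign_cyc[of "q - 1"] qh q4 by (cases q) auto
  ultimately have "sign x = 1"
    unfolding x_def by (subst sign_compose) (simp_all add: permutation_swap_id sign_swap_id)
  then have x_evenperm: "evenperm x"
    by (auto simp: sign_def split: if_splits)
  show ?thesis
  proof (rule prime_power_dvd_if_rotation[where q = q and x = x and Q = Q])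
    show "x \<in> p_elements (alt_group n) 2"
      using x_perm x_evenperm x_per by (auto simp: p_elements_alt_group)
    fix x y i
    assume x: "x \<in> p_elements (alt_group n) 2" and y: "y \<in> p_elements (alt_group n) 2"
      and xy: "x \<circ> y = y \<circ> x" and i: "rot q i x" "coprime i q" and Qx: "Q x"
    note xp = p_elements_alt_groupD[OF x] and yp = p_elements_alt_groupD[OF y]
    obtain a where a: "y ^^ (2 ^ a) = id"
      using yp(3) by blast
    have odd_i: "odd i"
      using i(2) qh by auto
    \<comment> \<open>If \<open>y 1\<close> were outside the block, \<open>x ^^ h\<close> would fix
      it and, by commutation, also fix \<open>1\<close>. But \<open>x ^^ h\<close> rotates the block
      by \<open>i * h\<close>, which is not a multiple of \<open>q\<close> for odd
      \<open>i\<close>.\<close>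
    have y1: "y 1 \<in> {1..q}"
    proof (rule ccontr)
      assume "y 1 \<notin> {1..q}"
      then have "(x ^^ h) (y 1) = y 1"
        using Qx by (simp add: Q_def)
      moreover have "(x ^^ h) (y 1) = y ((x ^^ h) 1)"
        using comp_funpow_commute[OF xy, of h] by (metis comp_apply)
      ultimately have "(x ^^ h) 1 = 1"
        using permutes_inj[OF yp(1)] by (simp add: inj_eq)
      then have "i * h mod q = 0"
        using rot_one[OF rot_funpow[OF i(1)], of h] q4 by simp
      then have "q dvd i * h"
        by (simp add: mod_eq_0_iff_dvd)
      then show False
        using odd_i qh q4 by simp
    qed
    obtain j where j: "rot q j y"
      using rot_commuting[OF i xy y1] by blast
    have "Q y"
      unfolding Q_def
    proof (intro allI impI)
      fix z assume z: "z \<notin> {1..q}"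
      show "(y ^^ h) z = z"
        by (rule rot_commuting_even_outside[OF qh q_def nq(2) xp(1,2) i(1) odd_i _ yp(1) a j xy z])
          (use Qx in \<open>simp add: Q_def\<close>)
    qed
    then show "y 1 \<in> {1..q} \<and> Q y"
      using y1 by blast
  qed (use rot_x \<open>Q x\<close> q4 nq q_def k2 in auto)
qed

section \<open>The Klein four-group\<close>

text \<open>The elements are indexed by the image of \<open>1\<close>, so that the index of a group
  element \<open>s\<close> is \<open>s 1\<close>.\<close>

definition klein :: "nat \<Rightarrow> nat \<Rightarrow> nat" where
  "klein i = (if i = 2 then transpose 1 2 \<circ> transpose 3 4
    else if i = 3 then transpose 1 3 \<circ> transpose 2 4
    else if i = 4 then transpose 1 4 \<circ> transpose 2 3 else id)"

lemma klein_cases: "i \<in> {1..4} \<Longrightarrow> i = 1 \<or> i = 2 \<or> i = 3 \<or> i = (4 :: nat)"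
  by auto

lemma klein_one: "i \<in> {1..4} \<Longrightarrow> klein i 1 = i"
  by (auto simp: klein_def transpose_def)

lemma klein_commute: "i \<in> {1..4} \<Longrightarrow> j \<in> {1..4} \<Longrightarrow> klein i (klein j z) = klein j (klein i z)"
  by (drule klein_cases, drule klein_cases, elim disjE) (simp_all add: klein_def transpose_def)

lemma klein_involution: "klein i (klein i z) = z"
  by (simp add: klein_def transpose_def)

lemma klein_permutes: "n \<ge> 4 \<Longrightarrow> klein i permutes {1..n}"
  unfolding klein_def by (auto intro!: permutes_compose permutes_swap_id permutes_id)

lemma sign_klein: "sign (klein i) = 1"
  unfolding klein_def by (auto simp: sign_compose permutation_swap_id sign_swap_id sign_id)

lemma klein_fixed_iff: "i \<in> {2..4} \<Longrightarrow> klein i z = z \<longleftrightarrow> z \<notin> {1..4}"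
  by (auto simp: klein_def transpose_def)

text \<open>Such a \<open>y\<close> preserves the support \<open>{1..4}\<close> of
  \<open>klein i\<close>. Correcting it by \<open>klein j\<close> with \<open>j = y 1\<close> gives
  an even \<open>t\<close> that fixes \<open>1\<close>, hence \<open>i\<close>, and everything
  outside the support. Only a swap of the last two points remains possible, and that is odd.\<close>

lemma commuting_klein:
  assumes n: "n \<le> 5" and i: "i \<in> {2..4}" and y: "y permutes {1..n}" "evenperm y"
    and comm: "klein i \<circ> y = y \<circ> klein i"
  shows "\<exists>j\<in>{1..4}. y = klein j"
proof -
  have comm': "klein i (y z) = y (klein i z)" for z
    using comm by (metis comp_apply)
  have y14: "y z \<in> {1..4} \<longleftrightarrow> z \<in> {1..4}" for z
    using klein_fixed_iff[OF i] comm'[of z] permutes_inj[OF y(1)] by (metis injD)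
  define j where "j = y 1"
  have j: "j \<in> {1..4}"
    using y14[of 1] by (simp add: j_def)
  define t where "t = klein j \<circ> y"
  have i14: "i \<in> {1..4}"
    using i by auto
  have t1: "t 1 = 1"
    using klein_involution[of j 1] klein_one[OF j] by (simp add: t_def j_def)
  have tcomm: "klein i (t z) = t (klein i z)" for z
    using comm'[of z] klein_commute[OF i14 j] by (simp add: t_def)
  have ti: "t i = i"
    using tcomm[of 1] t1 klein_one[OF i14] by simp
  have t_out: "t z = z" if "z \<notin> {1..4}" for z
  proof -
    have "y z = z"
    proof (cases "z \<in> {1..n}")
      case True
      then have "z = 5" "n = 5"
        using that n by auto
      have "y z \<in> {1..n}" "y z \<notin> {1..4}"
        using True that permutes_in_image[OF y(1)] y14[of z] by simp_all
      then show ?thesis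
        using \<open>z = 5\<close> \<open>n = 5\<close> by auto
    next
      case False
      then show ?thesis using permutes_not_in[OF y(1)] by blast
    qed
    moreover have "klein j z = z"
    proof -
      have "z \<noteq> 1" "z \<noteq> 2" "z \<noteq> 3" "z \<noteq> 4"
        using that by auto
      then show ?thesis
        by (simp add: klein_def transpose_def)
    qed
    ultimately show ?thesis
      by (simp add: t_def)
  qed
  have inj_t: "inj t"
    unfolding t_def using permutes_inj[OF y(1)] permutes_inj[OF klein_permutes[of 4 j]]
    by (intro inj_compose) auto
  obtain r s where rs: "r \<noteq> s" "{1..4} = {1, i, r, s}" "r \<notin> {1, i}" "s \<notin> {1, i}"
  proof -
    consider "i = 2" | "i = 3" | "i = 4"
      using i by force
    then show thesis
    proof cases
      case 1 then show ?thesis by (intro that[of 3 4]) auto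
    next
      case 2 then show ?thesis by (intro that[of 2 4]) auto
    next
      case 3 then show ?thesis by (intro that[of 2 3]) auto
    qed
  qed
  have perm_y: "permutation y"
    using y(1) permutation_permutes by blast
  have perm_k: "permutation (klein j)"
    using klein_permutes[of 4 j] permutation_permutes by blast
  have t_even: "sign t = 1"
    unfolding t_def using perm_y perm_k y(2) sign_klein by (subst sign_compose) (simp_all add: sign_def)
  have fixed: "t z = z" if "z \<noteq> r" "z \<noteq> s" for z
    using that rs(2) t1 ti t_out[of z] by (cases "z \<in> {1..4}") auto
  have "t r \<in> {r, s}" "t s \<in> {r, s}"
    using fixed inj_t rs by (metis injD insert_iff)+
  then have "t r = r \<and> t s = s \<or> t r = s \<and> t s = r"
    using injD[OF inj_t, of r s] rs(1) by auto
  then have "t = id \<or> t = transpose r s"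
  proof
    assume "t r = r \<and> t s = s"
    then have "t z = id z" for z
      using fixed[of z] by (cases "z = r"; cases "z = s") simp_all
    then show ?thesis by blast
  next
    assume "t r = s \<and> t s = r"
    then have "t z = transpose r s z" for z
      using fixed[of z] by (cases "z = r"; cases "z = s") simp_all
    then show ?thesis by blast
  qed
  moreover have "sign (transpose r s) = - 1"
    using rs(1) by (simp add: sign_swap_id)
  ultimately have "t = id"
    using t_even by auto
  then have "klein j (y z) = z" for z
    by (simp add: t_def fun_eq_iff)
  then have "y z = klein j z" for z
    by (metis klein_involution)
  then show ?thesis
    using j by blast
qed

text \<open>The condition \<open>q + 2 \<le> n\<close> would allow only \<open>q = 2\<close> here,
  too small for the rotation argument. Two conjugates of a character of the Klein group suffice, by
  the identity and by the transposition (2 3).\<close>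

lemma four_dvd_order_semichar_alt_group:
  assumes n: "n = 4 \<or> n = 5"
  shows "2 ^ 2 dvd order (semichar_group (alt_group n))"
proof -
  define S where "S = klein ` {1..4}"
  \<comment> \<open>This is the character of the Klein group with kernel
    \<open>{id, klein 3}\<close>; conjugating \<open>klein 2\<close> by (2 3) lands in that
    kernel.\<close>
  define F where "F s = (if s \<in> S \<and> s 1 \<in> {2, 4} then - 1 else 1 :: complex)" for s :: "nat \<Rightarrow> nat"
  have S_closed: "y \<in> S" if "y \<in> p_elements (alt_group n) 2" "x \<circ> y = y \<circ> x" "x \<in> S" "F x \<noteq> 1" for x y
  proof -
    note xS = that(3)
    obtain i where i: "i \<in> {1..4}" "x = klein i"
      using xS by (auto simp: S_def)
    then have "i \<in> {2..4}"
      using that(4) klein_one[OF i(1)] by (auto simp: F_def split: if_splits)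
    then show ?thesis
      using commuting_klein[of n i y] p_elements_alt_groupD[OF that(1)] that(2) i(2) n
      by (auto simp: S_def)
  qed
  interpret group "alt_group n"
    by (rule alt_group_is_group)
  have "2 ^ card {2, 3 :: nat} dvd order (semichar_group (alt_group n))"
  proof (rule prime_power_dvd_order_semichar_alt_group[where F = F and x = "klein 2" and g = "\<lambda>i. transpose 2 i"])
    show "F (x \<circ> y) = F x * F y"
      if "x \<in> p_elements (alt_group n) 2" "y \<in> p_elements (alt_group n) 2" "x \<circ> y = y \<circ> x" for x y
    proof (rule multiplicative_if_commuting_closed[where S = S, unfolded alt_group_mult, OF that])
      show "F s = 1" if "s \<notin> S" for s
        using that by (simp add: F_def)
      show "F (s \<circ> t) = F s * F t" if st: "s \<in> S" "t \<in> S" "s \<circ> t \<in> S" for s t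
      proof -
        obtain i j where ij: "i \<in> {1..4}" "s = klein i" "j \<in> {1..4}" "t = klein j"
          using st by (auto simp: S_def)
        have "F s = (if i \<in> {2, 4} then - 1 else 1)" "F t = (if j \<in> {2, 4} then - 1 else 1)"
          using st ij klein_one[OF ij(1)] klein_one[OF ij(3)] by (simp_all add: F_def)
        moreover have "F (s \<circ> t) = (if klein i j \<in> {2, 4} then - 1 else 1)"
          using st(3) ij klein_one[OF ij(3)] by (simp add: F_def)
        moreover have "klein i j \<in> {2, 4} \<longleftrightarrow> (i \<in> {2, 4}) \<noteq> (j \<in> {2, 4})"
          using klein_cases[OF ij(1)] klein_cases[OF ij(3)]
          by (elim disjE) (simp_all add: klein_def transpose_def)
        ultimately show ?thesis
          by auto
      qed
    next
      show "y \<in> S" if "y \<in> p_elements (alt_group n) 2" "x \<circ> y = y \<circ> x" "x \<in> S" "F x \<noteq> 1" for x y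
        using that by (rule S_closed)
    qed
    show "F s ^ 2 = 1" for s
      by (simp add: F_def)
    have "klein 2 ^^ (2 ^ 1) = id"
    proof
      fix z
      have "klein 2 ^^ (2 ^ 1) = klein 2 ^^ Suc (Suc 0)"
        by (rule arg_cong[where f = "\<lambda>k. klein 2 ^^ k"]) simp
      then show "(klein 2 ^^ (2 ^ 1)) z = id z"
        by (simp add: klein_involution)
    qed
    moreover have "evenperm (klein 2)"
      using sign_klein[of 2] by (auto simp: sign_def split: if_splits)
    moreover have "klein 2 permutes {1..n}"
      using n by (intro klein_permutes) auto
    ultimately show "klein 2 \<in> p_elements (alt_group n) 2"
      unfolding p_elements_alt_group by blast
    show "F (klein 2) \<noteq> 1"
      using klein_one[of 2] by (simp add: F_def S_def)
    show "transpose 2 i permutes {1..n}" if "i \<in> {2, 3}" for i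
      using that n by (intro permutes_swap_id) auto
    fix i j :: nat assume ij: "i \<in> {2, 3}" "j \<in> {2, 3}" "i \<noteq> j"
    have inv: "inv' (transpose (2 :: nat) l) = transpose 2 l" for l
      by (rule inv_unique_comp) simp_all
    have "(inv' (transpose 2 i) \<circ> (transpose 2 j \<circ> klein 2 \<circ> inv' (transpose 2 j)) \<circ> transpose 2 i) 1 = 3"
      unfolding inv using ij by (auto simp: klein_def transpose_def)
    then show "F (inv' (transpose 2 i) \<circ> (transpose 2 j \<circ> klein 2 \<circ> inv' (transpose 2 j)) \<circ> transpose 2 i) = 1"
      unfolding F_def by simp
  qed auto
  then show ?thesis
    by simp
qed

section \<open>Prime exponents in factorials\<close>

text \<open>Only multiples of \<open>p\<close> contribute, so with \<open>m = n div p\<close> the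
  exponent for \<open>n!\<close> is \<open>m\<close> plus the exponent for \<open>m!\<close>. The
  induction closes by \<open>(p - 1) * m + m = p * m \<le> n\<close>.\<close>

lemma multiplicity_fact_bound:
  assumes p: "prime p" and "n \<ge> 1"
  shows "(p - 1) * multiplicity p (fact n :: nat) + 1 \<le> n"
  using assms(2)
proof (induction n rule: less_induct)
  case (less n)
  have p1: "p > 1"
    using p by (rule prime_gt_1_nat)
  define m where "m = n div p"
  have mult_prod: "multiplicity p (fact k :: nat) = (\<Sum>j\<in>{1..k}. multiplicity p j)" for k
    using prime_elem_multiplicity_prod_distrib[of p "\<lambda>j. j" "{1..k}"] p by (simp add: fact_prod)
  have "(\<Sum>j\<in>{1..n}. multiplicity p j) = (\<Sum>j\<in>(*) p ` {1..m}. multiplicity p j)"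
  proof (rule sum.mono_neutral_right)
    show "(*) p ` {1..m} \<subseteq> {1..n}"
      using p1 by (auto simp: m_def less_eq_div_iff_mult_less_eq mult.commute)
    show "\<forall>j\<in>{1..n} - (*) p ` {1..m}. multiplicity p j = 0"
    proof
      fix j assume j: "j \<in> {1..n} - (*) p ` {1..m}"
      have "\<not> p dvd j"
      proof
        assume "p dvd j"
        then obtain c where c: "j = p * c" ..
        then have "c \<in> {1..m}"
          using j p1 by (auto simp: m_def less_eq_div_iff_mult_less_eq mult.commute Suc_le_eq)
        then show False
          using j c by blast
      qed
      then show "multiplicity p j = 0"
        by (rule not_dvd_imp_multiplicity_0)
    qed
  qed simp
  also have "\<dots> = (\<Sum>j\<in>{1..m}. multiplicity p (p * j))"
    using p1 by (subst sum.reindex) (auto simp: inj_on_def)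
  also have "\<dots> = (\<Sum>j\<in>{1..m}. 1 + multiplicity p j)"
  proof (rule sum.cong)
    fix j assume "j \<in> {1..m}"
    then have "multiplicity p (p * j) = Suc (multiplicity p j)"
      using p1 by (intro multiplicity_times_same) auto
    then show "multiplicity p (p * j) = 1 + multiplicity p j"
      by simp
  qed simp
  also have "\<dots> = m + (\<Sum>j\<in>{1..m}. multiplicity p j)"
    by (simp only: sum.distrib) simp
  finally have eq: "multiplicity p (fact n :: nat) = m + multiplicity p (fact m :: nat)"
    unfolding mult_prod .
  show ?case
  proof (cases "m = 0")
    case True
    then show ?thesis using eq less.prems by simp
  next
    case False
    then have "m < n"
      using p1 less.prems by (simp add: m_def)
    then have "(p - 1) * multiplicity p (fact m :: nat) + 1 \<le> m"
      using less.IH False by simp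
    then have "(p - 1) * multiplicity p (fact n :: nat) + 1 \<le> (p - 1) * m + m"
      unfolding eq by (simp add: add_mult_distrib2)
    also have "(p - 1) * m + m = p * m"
      using p1 by (cases p) auto
    also have "p * m \<le> n"
      by (simp add: m_def)
    finally show ?thesis .
  qed
qed

lemma dvd_if_multiplicity_le_power:
  fixes x y :: nat
  assumes "x \<noteq> 0" and "\<And>p. prime p \<Longrightarrow> p ^ multiplicity p x dvd y"
  shows "x dvd y"
proof (cases "y = 0")
  case False
  show ?thesis
  proof (rule multiplicity_le_imp_dvd[OF assms(1)])
    fix p :: nat assume "prime p"
    then show "multiplicity p x \<le> multiplicity p y"
      using assms(2) False by (intro multiplicity_geI) auto
  qed
qed simp

section \<open>Comparison of prime exponents with the order of the alternating group\<close>

theorem theorem4p5: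
  fixes n :: nat
  assumes "n \<ge> 1"
  shows "order (alt_group n) dvd order (semichar_group (alt_group n))"
proof (cases "n \<ge> 3")
  case False
  then consider "n = 1" | "n = 2"
    using assms by linarith
  then have "order (alt_group n) = 1"
  proof cases
    case 1
    have "carrier (alt_group 1) = {id}"
      by (auto simp: alt_group_carrier permutes_sing evenperm_id)
    then show ?thesis
      using 1 by (simp add: order_def)
  next
    case 2
    then show ?thesis
      using alt_group_card_carrier[of 2] by (simp add: order_def fact_2)
  qed
  then show ?thesis
    by simp
next
  case n: True
  let ?N = "order (alt_group n)"
  have N: "fact n = 2 * ?N"
    using alt_group_card_carrier[of n] n by (simp add: order_def)
  then have N0: "?N \<noteq> 0"
    by (metis fact_nonzero mult_0_right)
  show ?thesis
  proof (rule dvd_if_multiplicity_le_power[OF N0])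
    fix p :: nat assume p: "prime p"
    show "p ^ multiplicity p ?N dvd order (semichar_group (alt_group n))"
    proof (cases "p = 2")
      case True
      \<comment> \<open>The factorial has exponent at most \<open>n - 1\<close> at \<open>2\<close>,
        and halving it removes one more factor.\<close>
      have v: "multiplicity p ?N + 2 \<le> n"
      proof -
        have "multiplicity 2 (fact n :: nat) = Suc (multiplicity 2 ?N)"
          unfolding N by (rule multiplicity_times_same) (use N0 in auto)
        then show ?thesis
          using multiplicity_fact_bound[OF p, of n] n True by simp
      qed
      consider "n = 3" | "n = 4 \<or> n = 5" | "n \<ge> 6"
        using n by linarith
      then show ?thesis
      proof cases
        case 1
        then have "?N = 3"
          using N by (simp add: fact_numeral)
        then show ?thesis
          by (simp add: True not_dvd_imp_multiplicity_0)
      next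
        case 2
        then have "?N = 12 \<or> ?N = 60"
          using N by (auto simp: fact_numeral)
        then obtain c where c: "?N = 2 * (2 * c)" "odd c"
        proof
          assume "?N = 12"
          then show thesis by (intro that[of 3]) auto
        next
          assume "?N = 60"
          then show thesis by (intro that[of 15]) auto
        qed
        have "c \<noteq> 0"
          using c(2) by (metis dvd_0_right)
        then have "multiplicity 2 (2 * (2 * c)) = Suc (multiplicity 2 (2 * c))"
          by (intro multiplicity_times_same) auto
        also have "multiplicity 2 (2 * c) = Suc (multiplicity 2 c)"
          using \<open>c \<noteq> 0\<close> by (intro multiplicity_times_same) auto
        also have "multiplicity 2 c = 0"
          using c(2) by (rule not_dvd_imp_multiplicity_0)
        finally have "multiplicity p ?N = 2"
          unfolding c(1) True by simp
        then show ?thesis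
          using four_dvd_order_semichar_alt_group[OF 2] True by simp
      next
        case 3
        have "p ^ multiplicity p ?N dvd 2 ^ (n - 2)"
          using v by (simp add: True le_imp_power_dvd)
        then show ?thesis
          using two_power_dvd_order_semichar_alt_group[OF 3] by (rule dvd_trans)
      qed
    next
      case p2: False
      then have p_odd: "odd p"
        using primes_dvd_imp_eq[OF two_is_prime_nat p] by metis
      show ?thesis
      proof (cases "p \<le> n")
        case True
        have "p \<ge> 3"
          using prime_ge_2_nat[OF p] p2 by linarith
        have "multiplicity p (fact n :: nat) = multiplicity p ?N"
        proof -
          have "\<not> p dvd 2"
            using primes_dvd_imp_eq[OF p two_is_prime_nat] p2 by metis
          then have "multiplicity p (2 :: nat) = 0"
            by (rule not_dvd_imp_multiplicity_0)
          then show ?thesis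
            unfolding N using p N0 by (subst prime_elem_multiplicity_mult_distrib) auto
        qed
        then have "(p - 1) * multiplicity p ?N + 1 \<le> n"
          using multiplicity_fact_bound[OF p, of n] n by simp
        \<comment> \<open>With \<open>p\<close> at least \<open>3\<close>, twice the exponent is at
          most \<open>n - 1\<close>, which bounds the exponent by \<open>n - 2\<close> once
          \<open>n\<close> is at least \<open>3\<close>.\<close>
        moreover have "2 * multiplicity p ?N \<le> (p - 1) * multiplicity p ?N"
          using \<open>p \<ge> 3\<close> by (intro mult_le_mono1) auto
        ultimately have "multiplicity p ?N \<le> n - 2"
          using n by linarith
        then show ?thesis
          using odd_prime_power_dvd_order_semichar_alt_group[OF p p_odd True] by (meson dvd_trans le_imp_power_dvd)
      next
        case False
        then have "\<not> p dvd fact n"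
          using p by (simp add: prime_dvd_fact_iff)
        then have "\<not> p dvd ?N"
          unfolding N using dvd_mult by blast
        then show ?thesis
          by (simp add: not_dvd_imp_multiplicity_0)
      qed
    qed
  qed
qed

end
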